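(* Suppose that for every policy $\pi\in\Pi_1$ the induced state covariance satisfies $\Sigma_k\in\mathbb{S}_n^{++}$ for all $k\in\{0,\dots,N\}$. Let $\pi_1^\star\in\Pi_1$ be a minimizer of $J$ over $\Pi_1$ and let $\pi_2^\star\in\Pi_2$ be a minimizer of $J$ over $\Pi_2$. Put $J_1^\star=J(\pi_1^\star)$ and $J_2^\star=J(\pi_2^\star)$. Then $J_2^\star\le J_1^\star$.
   Context: $\mathbb{S}_n^{+}$ and $\mathbb{S}_n^{++}$ denote the real symmetric positive semidefinite and positive definite $n\times n$ matrices. System: for $k=0,\dots,N-1$, $x_{k+1}=A_kx_k+B_ku_k+w_k$, with $x_k\in\mathbb{R}^n$, $u_k\in\mathbb{R}^m$, given matrices $A_k\in\mathbb{R}^{n\times n}$, $B_k\in\mathbb{R}^{n\times m}$. The initial state is $x_0\sim\mathcal N(\mu_0,\Sigma_0)$ with $\Sigma_0\in\mathbb{S}_n^{++}$; $\{w_k\}$ is Gaussian white noise with $\mathbb{E}[w_k]=0$, $\mathbb{E}[w_kw_k^{\mathrm T}]=W_k\in\mathbb{S}_n^{+}$, $\mathbb{E}[w_kw_\ell^{\mathrm T}]=0$ for $k\ne\ell$; and $x_0,w_0,\dots,w_{N-1}$ are independent. State history feedback policies $\Pi_1$: policies of the form $u_k=v_k^{(1)}+\sum_{\tau=0}^{k}K^{(1)}_{k,\tau}(x_\tau-\bar x_\tau)$, $k=0,\dots,N-1$, where $\bar x_\tau=\mathbb{E}[x_\tau]$, with arbitrary parameters $v_k^{(1)}\in\mathbb{R}^m$,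 $K^{(1)}_{k,\tau}\in\mathbb{R}^{m\times n}$. Randomized state feedback policies $\Pi_2$: policies of the form $u_k=v_k^{(2)}+K_k^{(2)}(x_k-\bar x_k)+n_k$, $k=0,\dots,N-1$, where $\bar x_k=\mathbb{E}[x_k]$, with arbitrary parameters $v_k^{(2)}\in\mathbb{R}^m$, $K_k^{(2)}\in\mathbb{R}^{m\times n}$, $Q_k^{(2)}\in\mathbb{S}_m^{+}$, where $n_k\sim\mathcal N(0,Q_k^{(2)})$ and $n_0,\dots,n_{N-1}$ are mutually independent and independent of $x_0,w_0,\dots,w_{N-1}$. $\Sigma_k$ denotes the covariance matrix of $x_k$ under the policy considered. Objective: given $R_k\in\mathbb{S}_m^{++}$, $\lambda>0$, $\mu_{\mathrm d}\in\mathbb{R}^n$, $\Sigma_{\mathrm d}\in\mathbb{S}_n^{++}$, $$J(\pi)=\mathbb{E}\Big[\sum_{k=0}^{N-1}u_k^{\mathrm T}R_ku_k\Big]+\lambda\,W_2^2(\rho_N,\rho_{\mathrm d}),$$ where $\rho_N$ is the distribution of $x_N$ under $\pi$, $\rho_{\mathrm d}$ is $\mathcal N(\mu_{\mathrm d},\Sigma_{\mathrm d})$, and $W_2^2(\rho_1,\rho_2)=\inf\mathbb{E}\|x_1-x_2\|_2^2$, the infimum being over all couplings $(x_1,x_2)$ with finite second moments and marginals $\rho_1,\rho_2$. For Gaussians $\mathcal N(\mu_1,\Sigma_1)$ and $\mathcal N(\mu_2,\Sigma_2)$ it is known that $W_2^2=\|\mu_1-\mu_2\|_2^2+\operatorname{tr}(\Sigma_1+\Sigma_2)-2\operatorname{tr}\big((\sqrt{\Sigma_2}\,\Sigma_1\sqrt{\Sigma_2})^{1/2}\big)$.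 *)

theory Defs
  imports "HOL-Probability.Probability"
begin

definition psd :: "real ^ 'n ^ 'n \<Rightarrow> bool" where
  "psd S \<longleftrightarrow> transpose S = S \<and> (\<forall>x. 0 \<le> x \<bullet> (S *v x))"

definition pd :: "real ^ 'n ^ 'n \<Rightarrow> bool" where
  "pd S \<longleftrightarrow> transpose S = S \<and> (\<forall>x. x \<noteq> 0 \<longrightarrow> 0 < x \<bullet> (S *v x))"

(* For positive semidefinite S such a T exists and is unique. *)
definition psd_sqrt :: "real ^ 'n ^ 'n \<Rightarrow> real ^ 'n ^ 'n" where
  "psd_sqrt S = (SOME T. psd T \<and> T ** T = S)"

definition std_gaussian :: "(real ^ 'n) measure" where
  "std_gaussian = density lborel (\<lambda>z. ennreal (\<Prod>i\<in>UNIV. std_normal_density (z $ i)))"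

(* The normal law with mean mu and positive semidefinite, possibly singular, covariance S.
   It is a probability measure for every S, but only meaningful if S is positive semidefinite. *)
definition gaussian :: "real ^ 'n \<Rightarrow> real ^ 'n ^ 'n \<Rightarrow> (real ^ 'n) measure" where
  "gaussian mu S = distr std_gaussian borel (\<lambda>z. mu + psd_sqrt S *v z)"

definition covariance :: "'a measure \<Rightarrow> ('a \<Rightarrow> real ^ 'n) \<Rightarrow> real ^ 'n ^ 'n" where
  "covariance M X = (\<chi> i j. \<integral>\<omega>. (X \<omega> - integral\<^sup>L M X) $ i * (X \<omega> - integral\<^sup>L M X) $ j \<partial>M)"

(* A coupling is represented by the joint law of the pair; the marginals make it a
   probability measure whenever they are probability measures. *)
definition couplings ::
  "(real ^ 'n) measure \<Rightarrow> (real ^ 'n) measure \<Rightarrow> ((real ^ 'n) \<times> (real ^ 'n)) measure set" where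
  "couplings \<rho>1 \<rho>2 = {\<gamma>. sets \<gamma> = sets (borel \<Otimes>\<^sub>M borel) \<and>
     distr \<gamma> borel fst = \<rho>1 \<and> distr \<gamma> borel snd = \<rho>2 \<and>
     integrable \<gamma> (\<lambda>p. (norm (fst p))\<^sup>2) \<and> integrable \<gamma> (\<lambda>p. (norm (snd p))\<^sup>2)}"

(* Real-valued, hence meaningful only when both laws have finite second moments:
   otherwise the set of couplings is empty and the infimum is unspecified. *)
definition wasserstein2_sq :: "(real ^ 'n) measure \<Rightarrow> (real ^ 'n) measure \<Rightarrow> real" where
  "wasserstein2_sq \<rho>1 \<rho>2 =
     (INF \<gamma>\<in>couplings \<rho>1 \<rho>2. \<integral>p. (norm (fst p - snd p))\<^sup>2 \<partial>\<gamma>)"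

definition steering_cost ::
  "'a measure \<Rightarrow> nat \<Rightarrow> (nat \<Rightarrow> real ^ 'm ^ 'm) \<Rightarrow> real \<Rightarrow> (real ^ 'n) measure \<Rightarrow>
   (nat \<Rightarrow> 'a \<Rightarrow> real ^ 'm) \<Rightarrow> (nat \<Rightarrow> 'a \<Rightarrow> real ^ 'n) \<Rightarrow> real" where
  "steering_cost M N R lam \<rho>d u x =
     (\<integral>\<omega>. (\<Sum>k<N. u k \<omega> \<bullet> (R k *v u k \<omega>)) \<partial>M)
     + lam * wasserstein2_sq (distr M borel (x N)) \<rho>d"

(* A policy is identified with its parameters; entries with a time index k \<ge> N never matter. *)

type_synonym ('n, 'm) hist_policy =
  "(nat \<Rightarrow> real ^ 'm) \<times> (nat \<Rightarrow> nat \<Rightarrow> real ^ 'n ^ 'm)"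

type_synonym ('n, 'm) rand_policy =
  "(nat \<Rightarrow> real ^ 'm) \<times> (nat \<Rightarrow> real ^ 'n ^ 'm) \<times> (nat \<Rightarrow> real ^ 'm ^ 'm)"

definition hist_policies :: "('n::finite, 'm::finite) hist_policy set" where
  "hist_policies = UNIV"

definition rand_policies :: "nat \<Rightarrow> ('n::finite, 'm::finite) rand_policy set" where
  "rand_policies N = {(v, K, Q). \<forall>k<N. psd (Q k)}"

(* The input at time k uses the means of the very closed-loop states x_0, ..., x_k it feeds back. *)
function (sequential)
  hist_state :: "'a measure \<Rightarrow> (nat \<Rightarrow> real ^ 'n ^ 'n) \<Rightarrow> (nat \<Rightarrow> real ^ 'm ^ 'n) \<Rightarrow>
    ('a \<Rightarrow> real ^ 'n) \<Rightarrow> (nat \<Rightarrow> 'a \<Rightarrow> real ^ 'n) \<Rightarrow> ('n, 'm) hist_policy \<Rightarrow>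
    nat \<Rightarrow> 'a \<Rightarrow> real ^ 'n"
and
  hist_input :: "'a measure \<Rightarrow> (nat \<Rightarrow> real ^ 'n ^ 'n) \<Rightarrow> (nat \<Rightarrow> real ^ 'm ^ 'n) \<Rightarrow>
    ('a \<Rightarrow> real ^ 'n) \<Rightarrow> (nat \<Rightarrow> 'a \<Rightarrow> real ^ 'n) \<Rightarrow> ('n, 'm) hist_policy \<Rightarrow>
    nat \<Rightarrow> 'a \<Rightarrow> real ^ 'm"
where
  "hist_state M A B x0 w \<pi> 0 = x0"
| "hist_state M A B x0 w \<pi> (Suc k) =
     (\<lambda>\<omega>. A k *v hist_state M A B x0 w \<pi> k \<omega> + B k *v hist_input M A B x0 w \<pi> k \<omega> + w k \<omega>)"
| "hist_input M A B x0 w \<pi> k =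
     (\<lambda>\<omega>. fst \<pi> k + (\<Sum>\<tau>\<le>k. snd \<pi> k \<tau> *v
        (hist_state M A B x0 w \<pi> \<tau> \<omega> - integral\<^sup>L M (hist_state M A B x0 w \<pi> \<tau>))))"
  by pat_completeness auto
termination
  by (relation "Wellfounded.measure (case_sum (\<lambda>(_, _, _, _, _, _, k). 2 * k)
       (\<lambda>(_, _, _, _, _, _, k). 2 * k + 1))") auto

definition hist_cost ::
  "'a measure \<Rightarrow> nat \<Rightarrow> (nat \<Rightarrow> real ^ 'n ^ 'n) \<Rightarrow> (nat \<Rightarrow> real ^ 'm ^ 'n) \<Rightarrow>
   ('a \<Rightarrow> real ^ 'n) \<Rightarrow> (nat \<Rightarrow> 'a \<Rightarrow> real ^ 'n) \<Rightarrow> (nat \<Rightarrow> real ^ 'm ^ 'm) \<Rightarrow> real \<Rightarrow>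
   (real ^ 'n) measure \<Rightarrow> ('n, 'm) hist_policy \<Rightarrow> real" where
  "hist_cost M N A B x0 w R lam \<rho>d \<pi> =
     steering_cost M N R lam \<rho>d (hist_input M A B x0 w \<pi>) (hist_state M A B x0 w \<pi>)"

(* X is meant to be the closed-loop state at time k. *)
definition rand_feedback ::
  "'a measure \<Rightarrow> (nat \<Rightarrow> 'a \<Rightarrow> real ^ 'm) \<Rightarrow> (nat \<Rightarrow> real ^ 'm) \<Rightarrow> (nat \<Rightarrow> real ^ 'n ^ 'm) \<Rightarrow>
   nat \<Rightarrow> ('a \<Rightarrow> real ^ 'n) \<Rightarrow> 'a \<Rightarrow> real ^ 'm" where
  "rand_feedback M nz v K k X = (\<lambda>\<omega>. v k + K k *v (X \<omega> - integral\<^sup>L M X) + nz k \<omega>)"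

fun rand_state ::
  "'a measure \<Rightarrow> (nat \<Rightarrow> real ^ 'n ^ 'n) \<Rightarrow> (nat \<Rightarrow> real ^ 'm ^ 'n) \<Rightarrow>
   ('a \<Rightarrow> real ^ 'n) \<Rightarrow> (nat \<Rightarrow> 'a \<Rightarrow> real ^ 'n) \<Rightarrow> (nat \<Rightarrow> 'a \<Rightarrow> real ^ 'm) \<Rightarrow>
   (nat \<Rightarrow> real ^ 'm) \<Rightarrow> (nat \<Rightarrow> real ^ 'n ^ 'm) \<Rightarrow> nat \<Rightarrow> 'a \<Rightarrow> real ^ 'n"
where
  "rand_state M A B x0 w nz v K 0 = x0"
| "rand_state M A B x0 w nz v K (Suc k) =
     (\<lambda>\<omega>. A k *v rand_state M A B x0 w nz v K k \<omega>
        + B k *v rand_feedback M nz v K k (rand_state M A B x0 w nz v K k) \<omega> + w k \<omega>)"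

definition rand_input ::
  "'a measure \<Rightarrow> (nat \<Rightarrow> real ^ 'n ^ 'n) \<Rightarrow> (nat \<Rightarrow> real ^ 'm ^ 'n) \<Rightarrow>
   ('a \<Rightarrow> real ^ 'n) \<Rightarrow> (nat \<Rightarrow> 'a \<Rightarrow> real ^ 'n) \<Rightarrow> (nat \<Rightarrow> 'a \<Rightarrow> real ^ 'm) \<Rightarrow>
   (nat \<Rightarrow> real ^ 'm) \<Rightarrow> (nat \<Rightarrow> real ^ 'n ^ 'm) \<Rightarrow> nat \<Rightarrow> 'a \<Rightarrow> real ^ 'm"
where
  "rand_input M A B x0 w nz v K k = rand_feedback M nz v K k (rand_state M A B x0 w nz v K k)"

(* The space carrying x0 and w need not carry the randomization, so it is enlarged by an
   independent factor whose coordinates are the independent noises n_k of law N(0, Q_k). *)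
definition rand_space ::
  "'a measure \<Rightarrow> nat \<Rightarrow> (nat \<Rightarrow> real ^ 'm ^ 'm) \<Rightarrow> ('a \<times> (nat \<Rightarrow> real ^ 'm)) measure" where
  "rand_space M N Q = M \<Otimes>\<^sub>M (\<Pi>\<^sub>M k\<in>{..<N}. gaussian 0 (Q k))"

definition rand_cost ::
  "'a measure \<Rightarrow> nat \<Rightarrow> (nat \<Rightarrow> real ^ 'n ^ 'n) \<Rightarrow> (nat \<Rightarrow> real ^ 'm ^ 'n) \<Rightarrow>
   ('a \<Rightarrow> real ^ 'n) \<Rightarrow> (nat \<Rightarrow> 'a \<Rightarrow> real ^ 'n) \<Rightarrow> (nat \<Rightarrow> real ^ 'm ^ 'm) \<Rightarrow> real \<Rightarrow>
   (real ^ 'n) measure \<Rightarrow> ('n, 'm) rand_policy \<Rightarrow> real" where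
  "rand_cost M N A B x0 w R lam \<rho>d = (\<lambda>(v, K, Q).
     let P = rand_space M N Q;
         X0 = (\<lambda>\<omega>. x0 (fst \<omega>));
         w' = (\<lambda>k \<omega>. w k (fst \<omega>));
         nz = (\<lambda>k \<omega>. snd \<omega> k)
     in steering_cost P N R lam \<rho>d (rand_input P A B X0 w' nz v K) (rand_state P A B X0 w' nz v K))"

end

theory Submission
  imports Defs
begin

text \<open>
The cost of a policy depends on it only through the means and covariances of the inputs
$u_k$ and the law of the terminal state. A history feedback policy has Gaussian closed-loop
variables, so it suffices to reproduce the means and covariances of $x_k$ and $u_k$ by a randomized
policy: the costs then agree exactly, and a minimizer over the randomized policies costs no more.

The randomized policy comes from linear regression. Write $X_k$ and $U_k$ for the deviations of
$x_k$ and $u_k$ from their means, $\Sigma_k = E[X_k X_k^T] > 0$, and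
$K_k = E[U_k X_k^T] \Sigma_k^{-1}$. The residual $V_k = U_k - K_k X_k$ is uncorrelated with $X_k$.
Replacing it by an independent noise $n_k$ with the same covariance $Q_k = E[V_k V_k^T]$, which is
positive semidefinite, changes neither $E[U_k X_k^T]$ nor $E[U_k U_k^T]$. Since $w_k$ is uncorrelated
with $X_k$ and $U_k$ in both closed loops, these two matrices and $\Sigma_k$ determine the covariance
of $x_{k+1}$, and induction on $k$ shows that the two loops have the same second-order statistics
(lemma \<open>exists_rand_policy_same_cost\<close>). The same open-loop inputs $v_k$ give the same means.

Equality of second moments is enough for the running cost. For the Wasserstein term the
terminal laws must coincide. All deviations in a closed loop lie in a linear space of scalar random
variables each of which is centred and Gaussian (locale \<open>gaussian_space\<close>). The
characteristic function of such a vector is a function of its covariance alone, and a probability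
measure on Euclidean space is determined by its characteristic function
(lemma \<open>measure_eqI_char\<close>). No state law needs a density for this, so singular
disturbances are covered.

Finally, \<open>gaussian\<close> is defined through a square root of the covariance matrix. That
\<open>gaussian 0 Q\<close> has covariance $Q$ therefore rests on the existence of square roots of
positive semidefinite matrices, obtained from an orthonormal eigenbasis.
\<close>

section \<open>Square roots of positive semidefinite matrices\<close>

text \<open>
The first-order condition at a minimum, in algebraic form: a quadratic polynomial in $t$ that vanishes
at $0$ and is nowhere negative has no linear term.
\<close>

lemma quadratic_nonneg_linear_zero:
  fixes b c :: real
  assumes "\<And>t. 0 \<le> 2 * t * b + t\<^sup>2 * c"
  shows "b = 0"
proof (rule ccontr)
  assume b: "b \<noteq> 0"
  have c: "0 < c + 1"
    using assms[of 1] assms[of "-1"] by simp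
  \<comment> \<open>the minimizer would be $-b/c$; the shift by 1 covers the case $c = 0$\<close>
  have "0 \<le> 2 * (- b / (c + 1)) * b + (- b / (c + 1))\<^sup>2 * c"
    by (rule assms)
  also have "\<dots> = - (b\<^sup>2 * (c + 2) / (c + 1)\<^sup>2)"
    using c by (simp add: divide_simps) (simp add: algebra_simps power2_eq_square)
  also have "\<dots> < 0"
    using b c by (simp add: divide_pos_pos)
  finally show False by simp
qed

text \<open>
The Rayleigh quotient attains its maximum $c$ on the compact unit sphere of $V$. At a maximizer $b$ the
form $c \, (y \bullet y) - y \bullet f(y)$ is nonnegative on $V$ and vanishes at $b$, so its derivative at $b$ vanishes in
every direction of $V$; this derivative is twice the inner product with $c \, b - f(b)$, which itself lies in $V$.
\<close>

lemma self_adjoint_eigenvector: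
  fixes f :: "'a :: euclidean_space \<Rightarrow> 'a"
  assumes lin: "linear f" and sa: "\<And>x y. f x \<bullet> y = x \<bullet> f y"
    and V: "subspace V" "\<And>x. x \<in> V \<Longrightarrow> f x \<in> V" and ne: "V \<noteq> {0}"
  obtains b c where "b \<in> V" "norm b = 1" "f b = c *\<^sub>R b"
proof -
  let ?S = "{x \<in> V. norm x = 1}"
  have S: "?S = V \<inter> sphere 0 1"
    by (auto simp: dist_norm)
  have "compact ?S"
    unfolding S using V(1) by (intro closed_Int_compact closed_subspace) auto
  moreover obtain v where v: "v \<in> V" "v \<noteq> 0"
    using ne subspace_0[OF V(1)] by auto
  have "v /\<^sub>R norm v \<in> ?S"
    using v V(1) by (simp add: subspace_scale)
  then have "?S \<noteq> {}" by blast
  moreover have "continuous_on ?S (\<lambda>x. x \<bullet> f x)"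
    using linear_continuous_on[of f] lin
    by (intro continuous_intros) (auto simp: linear_conv_bounded_linear)
  ultimately obtain b where b: "b \<in> ?S" "\<And>y. y \<in> ?S \<Longrightarrow> y \<bullet> f y \<le> b \<bullet> f b"
    using continuous_attains_sup[of ?S "\<lambda>x. x \<bullet> f x"] by blast
  define c where "c = b \<bullet> f b"
  have max: "y \<bullet> f y \<le> c * (y \<bullet> y)" if "y \<in> V" for y
  proof (cases "y = 0")
    case False
    have "y /\<^sub>R norm y \<in> ?S"
      using that False V(1) by (simp add: subspace_scale)
    from b(2)[OF this] have "(y \<bullet> f y) / (norm y)\<^sup>2 \<le> c"
      by (simp add: c_def linear_scale[OF lin] field_simps power2_eq_square)
    then show ?thesis
      using False by (simp add: field_simps power2_norm_eq_inner)
  qed simp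
  have bb: "b \<bullet> b = 1"
    using b(1) by (simp add: norm_eq_1)
  have orth: "y \<bullet> (c *\<^sub>R b - f b) = 0" if y: "y \<in> V" for y
  proof (rule quadratic_nonneg_linear_zero)
    fix t :: real
    have "b + t *\<^sub>R y \<in> V"
      using b(1) y V(1) by (simp add: subspace_add subspace_scale)
    from max[OF this] show "0 \<le> 2 * t * (y \<bullet> (c *\<^sub>R b - f b)) + t\<^sup>2 * (c * (y \<bullet> y) - y \<bullet> f y)"
      using sa[of b y] bb
      by (simp add: linear_add[OF lin] linear_scale[OF lin] inner_simps c_def
          inner_commute algebra_simps power2_eq_square)
  qed
  have "c *\<^sub>R b - f b \<in> V"
    using b(1) V by (simp add: subspace_diff subspace_scale)
  from orth[OF this] have "f b = c *\<^sub>R b" by simp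
  with b(1) show thesis by (intro that[of b c]) auto
qed

text \<open>
Split off one eigenvector and continue in its orthogonal complement within $V$, which is again
invariant because $f$ is self-adjoint.
\<close>

lemma self_adjoint_eigenbasis:
  fixes f :: "'a :: euclidean_space \<Rightarrow> 'a"
  assumes lin: "linear f" and sa: "\<And>x y. f x \<bullet> y = x \<bullet> f y"
    and "subspace V" "\<And>x. x \<in> V \<Longrightarrow> f x \<in> V"
  shows "\<exists>E c. finite E \<and> E \<subseteq> V \<and> (\<forall>b\<in>E. norm b = 1 \<and> f b = c b *\<^sub>R b)
    \<and> (\<forall>b\<in>E. \<forall>b'\<in>E. b \<noteq> b' \<longrightarrow> b \<bullet> b' = 0) \<and> V \<subseteq> span E"
  using assms(3,4)
proof (induction "dim V" arbitrary: V rule: less_induct)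
  case less
  show ?case
  proof (cases "V = {0}")
    case True
    then show ?thesis by (intro exI[of _ "{}"]) auto
  next
    case False
    then obtain b c where b: "b \<in> V" "norm b = 1" "f b = c *\<^sub>R b"
      using self_adjoint_eigenvector[OF lin sa less.prems] by metis
    have bb: "b \<bullet> b = 1" using b(2) by (simp add: norm_eq_1)
    define V' where "V' = {x \<in> V. b \<bullet> x = 0}"
    have sub: "subspace V'"
      using less.prems(1) by (auto simp: V'_def subspace_def inner_simps)
    have inv: "f x \<in> V'" if "x \<in> V'" for x
      using that less.prems(2) sa[of b x] b(3) by (auto simp: V'_def)
    have "b \<notin> V'" using bb by (simp add: V'_def)
    have "V' \<subseteq> V" by (auto simp: V'_def)
    with \<open>b \<notin> V'\<close> have "V' \<subset> V" using b(1) by blast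
    moreover have sp: "span V' = V'" "span V = V"
      using sub less.prems(1) by (simp_all only: span_eq_iff)
    ultimately have "dim V' < dim V"
      using dim_psubset[of V' V] unfolding sp by blast
    from less.hyps[OF this sub inv] obtain E e where E: "finite E" "E \<subseteq> V'"
      "\<forall>b\<in>E. norm b = 1 \<and> f b = e b *\<^sub>R b"
      "\<forall>b\<in>E. \<forall>b'\<in>E. b \<noteq> b' \<longrightarrow> b \<bullet> b' = 0" "V' \<subseteq> span E"
      by blast
    have "b \<notin> E" using \<open>b \<notin> V'\<close> E(2) by blast
    have "x \<in> span (insert b E)" if "x \<in> V" for x
    proof -
      have "x - (b \<bullet> x) *\<^sub>R b \<in> V'"
        using that b(1) bb less.prems(1) by (simp add: V'_def subspace_diff subspace_scale inner_simps)
      then have "x - (b \<bullet> x) *\<^sub>R b \<in> span E" using E(5) by blast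
      then show ?thesis by (auto simp: span_insert)
    qed
    then show ?thesis
    proof (intro exI[of _ "insert b E"] exI[of _ "e(b := c)"] conjI)
      have "b \<bullet> b' = 0" if "b' \<in> E" for b'
        using that E(2) by (auto simp: V'_def)
      then show "\<forall>b1\<in>insert b E. \<forall>b2\<in>insert b E. b1 \<noteq> b2 \<longrightarrow> b1 \<bullet> b2 = 0"
        using E(4) by (metis insert_iff inner_commute)
    qed (use E b \<open>b \<notin> E\<close> \<open>V' \<subseteq> V\<close> in auto)
  qed
qed

text \<open>
In an orthonormal eigenbasis the square root takes the square roots of the eigenvalues, which are
nonnegative.
\<close>

lemma psd_has_sqrt:
  fixes S :: "real ^ 'n ^ 'n"
  assumes "psd S"
  shows "\<exists>T. psd T \<and> T ** T = S"
proof -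
  have sa: "(S *v x) \<bullet> y = x \<bullet> (S *v y)" for x y
    using assms unfolding psd_def by (metis dot_lmul_matrix vector_transpose_matrix)
  obtain E c where *: "finite E" "\<forall>b\<in>E. norm b = 1 \<and> S *v b = c b *\<^sub>R b"
      "\<forall>b\<in>E. \<forall>b'\<in>E. b \<noteq> b' \<longrightarrow> b \<bullet> b' = 0" "UNIV \<subseteq> span E"
    using self_adjoint_eigenbasis[OF matrix_vector_mul_linear sa subspace_UNIV UNIV_I] by blast
  then have E: "finite E" "\<And>b. b \<in> E \<Longrightarrow> norm b = 1" "\<And>b. b \<in> E \<Longrightarrow> S *v b = c b *\<^sub>R b"
      "\<And>b b'. b \<in> E \<Longrightarrow> b' \<in> E \<Longrightarrow> b \<noteq> b' \<Longrightarrow> b \<bullet> b' = 0" "span E = UNIV"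
    by auto
  have inner: "b \<bullet> b' = (if b = b' then 1 else 0)" if "b \<in> E" "b' \<in> E" for b b'
    using that E(2,4) by (auto simp: norm_eq_1)
  have c: "0 \<le> c b" if "b \<in> E" for b
    using assms E(3)[OF that] inner[OF that that] unfolding psd_def
    by (metis inner_scaleR_right mult.right_neutral)
  define g where "g x = (\<Sum>b\<in>E. (sqrt (c b) * (b \<bullet> x)) *\<^sub>R b)" for x
  have lin: "linear g"
    unfolding g_def
    by (intro linearI) (simp_all add: inner_simps algebra_simps sum.distrib scaleR_sum_right)
  let ?T = "matrix g"
  have T: "?T *v x = g x" for x
    using lin by simp
  have gb: "g b = sqrt (c b) *\<^sub>R b" if "b \<in> E" for b
    unfolding g_def using that E(1)
    by (subst sum.remove[of _ b]) (auto simp: inner)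
  have "g x \<bullet> y = x \<bullet> g y" for x y
    by (simp add: g_def inner_sum_left inner_sum_right inner_commute ac_simps)
  then have "x \<bullet> (transpose ?T *v y) = x \<bullet> (?T *v y)" for x y
    unfolding T by (metis T dot_lmul_matrix vector_transpose_matrix)
  then have "transpose ?T *v y = ?T *v y" for y
    using vector_eq_ldot[of "transpose ?T *v y" "?T *v y"] by blast
  then have "transpose ?T = ?T"
    unfolding matrix_eq by blast
  moreover have "0 \<le> x \<bullet> (?T *v x)" for x
  proof -
    have "x \<bullet> g x = (\<Sum>b\<in>E. sqrt (c b) * (b \<bullet> x)\<^sup>2)"
      unfolding g_def inner_sum_right
      by (intro sum.cong) (simp_all add: power2_eq_square inner_commute[of x])
    also have "0 \<le> \<dots>"
      by (intro sum_nonneg mult_nonneg_nonneg) (simp_all add: c)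
    finally show ?thesis unfolding T .
  qed
  ultimately have "psd ?T" by (simp add: psd_def)
  moreover have "g (g x) = S *v x" for x
  proof (rule linear_eq_on_span[of "\<lambda>x. g (g x)" "(*v) S" E])
    show "linear (\<lambda>x. g (g x))"
      using linear_compose[OF lin lin] by (simp add: o_def)
    show "g (g b) = S *v b" if "b \<in> E" for b
      using that by (simp add: gb linear_scale[OF lin] E(3) c)
    show "x \<in> span E" by (simp add: E(5))
  qed simp
  then have "?T ** ?T = S"
    by (simp add: matrix_eq T flip: matrix_vector_mul_assoc)
  ultimately show ?thesis by blast
qed

lemma psd_sqrt_works:
  assumes "psd S"
  shows "transpose (psd_sqrt S) = psd_sqrt S" "psd_sqrt S ** psd_sqrt S = S"
  using someI_ex[OF psd_has_sqrt[OF assms]] by (auto simp: psd_sqrt_def psd_def)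

section \<open>Centred Gaussian variables and the standard normal law\<close>

text \<open>
Normality is expressed by the characteristic function rather than by a density, so that the degenerate
variable $0$ is included. The class is then closed under all scalings and under independent sums.
\<close>

definition centred_gaussian :: "'a measure \<Rightarrow> ('a \<Rightarrow> real) \<Rightarrow> bool" where
  "centred_gaussian M f \<longleftrightarrow> f \<in> borel_measurable M \<and> integrable M (\<lambda>\<omega>. (f \<omega>)\<^sup>2) \<and>
     integral\<^sup>L M f = 0 \<and>
     (\<forall>s. char (distr M borel f) s = complex_of_real (exp (- (s\<^sup>2 * (\<integral>\<omega>. (f \<omega>)\<^sup>2 \<partial>M)) / 2)))"

lemma centred_gaussianD:
  assumes "centred_gaussian M f"
  shows "f \<in> borel_measurable M" "integrable M (\<lambda>\<omega>. (f \<omega>)\<^sup>2)" "integral\<^sup>L M f = 0"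
    "char (distr M borel f) s = complex_of_real (exp (- (s\<^sup>2 * (\<integral>\<omega>. (f \<omega>)\<^sup>2 \<partial>M)) / 2))"
  using assms by (auto simp: centred_gaussian_def)

lemma char_distr:
  "f \<in> borel_measurable M \<Longrightarrow> char (distr M borel f) s = (\<integral>\<omega>. iexp (s * f \<omega>) \<partial>M)"
  unfolding char_def by (subst integral_distr) auto

lemma centred_gaussian_scale:
  assumes f: "centred_gaussian M f"
  shows "centred_gaussian M (\<lambda>\<omega>. c * f \<omega>)"
proof -
  note [measurable] = centred_gaussianD(1)[OF f]
  have "char (distr M borel (\<lambda>\<omega>. c * f \<omega>)) s = char (distr M borel f) (s * c)" for s
    by (simp add: char_distr mult.assoc)
  then show ?thesis
    using centred_gaussianD[OF f]
    by (simp add: centred_gaussian_def power_mult_distrib mult.assoc)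
qed

lemma centred_gaussian_distr:
  assumes [measurable]: "T \<in> measurable M M'" and f: "centred_gaussian (distr M M' T) f"
  shows "centred_gaussian M (\<lambda>\<omega>. f (T \<omega>))"
proof -
  have [measurable]: "f \<in> borel_measurable M'"
    using centred_gaussianD(1)[OF f] by simp
  show ?thesis
    using f by (simp add: centred_gaussian_def integral_distr integrable_distr_eq char_distr)
qed

lemma (in prob_space) integrable_mult_of_squares:
  fixes f g :: "'a \<Rightarrow> real"
  assumes [measurable]: "f \<in> borel_measurable M" "g \<in> borel_measurable M"
    and "integrable M (\<lambda>\<omega>. (f \<omega>)\<^sup>2)" "integrable M (\<lambda>\<omega>. (g \<omega>)\<^sup>2)"
  shows "integrable M (\<lambda>\<omega>. f \<omega> * g \<omega>)"
proof (rule Bochner_Integration.integrable_bound)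
  show "integrable M (\<lambda>\<omega>. (f \<omega>)\<^sup>2 + (g \<omega>)\<^sup>2)" using assms by simp
  have "2 * (\<bar>x\<bar> * \<bar>y\<bar>) \<le> x\<^sup>2 + y\<^sup>2" for x y :: real
    using sum_squares_bound[of "\<bar>x\<bar>" "\<bar>y\<bar>"] by simp
  then have "\<bar>x\<bar> * \<bar>y\<bar> \<le> x\<^sup>2 + y\<^sup>2" for x y :: real
    by (smt (verit) mult_nonneg_nonneg abs_ge_zero)
  then show "AE \<omega> in M. norm (f \<omega> * g \<omega>) \<le> norm ((f \<omega>)\<^sup>2 + (g \<omega>)\<^sup>2)"
    by (auto simp: abs_mult)
qed measurable

lemma (in prob_space) integrable_of_square:
  fixes f :: "'a \<Rightarrow> real"
  assumes [measurable]: "f \<in> borel_measurable M" and "integrable M (\<lambda>\<omega>. (f \<omega>)\<^sup>2)"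
  shows "integrable M f"
  using integrable_mult_of_squares[of f "\<lambda>_. 1"] assms by simp

lemma (in prob_space) centred_gaussian_zero: "centred_gaussian M (\<lambda>_. 0)"
  unfolding centred_gaussian_def by (subst char_distr) (simp_all add: prob_space)

lemma (in prob_space) centred_gaussian_add_indep:
  assumes f: "centred_gaussian M f" and g: "centred_gaussian M g" and ind: "indep_var borel f borel g"
  shows "centred_gaussian M (\<lambda>\<omega>. f \<omega> + g \<omega>)"
    and "(\<integral>\<omega>. (f \<omega> + g \<omega>)\<^sup>2 \<partial>M) = (\<integral>\<omega>. (f \<omega>)\<^sup>2 \<partial>M) + (\<integral>\<omega>. (g \<omega>)\<^sup>2 \<partial>M)"
proof -
  note F = centred_gaussianD[OF f] and G = centred_gaussianD[OF g]
  note [measurable] = F(1) G(1)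
  have int: "integrable M f" "integrable M g"
    using F G by (auto intro: integrable_of_square)
  have "(\<integral>\<omega>. f \<omega> * g \<omega> \<partial>M) = 0"
    using indep_var_lebesgue_integral[OF ind int] F(3) by simp
  moreover have sq: "(\<lambda>\<omega>. (f \<omega> + g \<omega>)\<^sup>2) = (\<lambda>\<omega>. (f \<omega>)\<^sup>2 + 2 * (f \<omega> * g \<omega>) + (g \<omega>)\<^sup>2)"
    by (simp add: power2_sum fun_eq_iff)
  moreover have fg: "integrable M (\<lambda>\<omega>. f \<omega> * g \<omega>)"
    using F G by (intro integrable_mult_of_squares) auto
  ultimately show var: "(\<integral>\<omega>. (f \<omega> + g \<omega>)\<^sup>2 \<partial>M) = (\<integral>\<omega>. (f \<omega>)\<^sup>2 \<partial>M) + (\<integral>\<omega>. (g \<omega>)\<^sup>2 \<partial>M)"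
    using F G by simp
  have "integrable M (\<lambda>\<omega>. (f \<omega> + g \<omega>)\<^sup>2)"
    unfolding sq using F G fg by simp
  then show "centred_gaussian M (\<lambda>\<omega>. f \<omega> + g \<omega>)"
    unfolding centred_gaussian_def var
    using F G int
    by (auto simp: char_distr_add[OF ind] algebra_simps add_divide_distrib simp flip: exp_add of_real_mult)
qed

text \<open>
Variances and logarithms of characteristic functions are both additive over independent summands.
\<close>

lemma (in prob_space) centred_gaussian_sum_indep:
  assumes "finite I" "indep_vars (\<lambda>_. borel) X I" "\<And>i. i \<in> I \<Longrightarrow> centred_gaussian M (X i)"
  shows "centred_gaussian M (\<lambda>\<omega>. \<Sum>i\<in>I. X i \<omega>) \<and>
    (\<integral>\<omega>. (\<Sum>i\<in>I. X i \<omega>)\<^sup>2 \<partial>M) = (\<Sum>i\<in>I. \<integral>\<omega>. (X i \<omega>)\<^sup>2 \<partial>M)"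
  using assms
proof (induction I)
  case empty
  then show ?case by (simp add: centred_gaussian_zero)
next
  case (insert i I)
  have "indep_vars (\<lambda>_. borel) X I"
    using insert.prems(1) by (rule indep_vars_subset) auto
  with insert have IH: "centred_gaussian M (\<lambda>\<omega>. \<Sum>i\<in>I. X i \<omega>)"
      "(\<integral>\<omega>. (\<Sum>i\<in>I. X i \<omega>)\<^sup>2 \<partial>M) = (\<Sum>i\<in>I. \<integral>\<omega>. (X i \<omega>)\<^sup>2 \<partial>M)"
    by auto
  have "indep_var borel (X i) borel (\<lambda>\<omega>. \<Sum>i\<in>I. X i \<omega>)"
    using insert by (intro indep_vars_sum) auto
  from centred_gaussian_add_indep[OF _ IH(1) this] IH(2) insert show ?case
    by auto
qed

lemma centred_gaussian_std_normal: "centred_gaussian std_normal_distribution (\<lambda>x. x)"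
  and second_moment_std_normal: "(\<integral>x. x\<^sup>2 \<partial>std_normal_distribution) = 1"
proof -
  show 1: "(\<integral>x. x\<^sup>2 \<partial>std_normal_distribution) = 1"
    using std_normal_distribution_even_moments(1)[of 1] by simp
  have "char (distr std_normal_distribution borel (\<lambda>x. x)) = char std_normal_distribution"
    by (rule ext) (simp add: char_distr, simp add: char_def)
  then show "centred_gaussian std_normal_distribution (\<lambda>x. x)"
    using std_normal_distribution_even_moments(2)[of 1] integral_std_normal_distribution_moment_odd[of 1] 1
    by (simp add: centred_gaussian_def char_std_normal_distribution)
qed

text \<open>
Tonelli's theorem for product integrands, transferred from the canonical basis to coordinates indexed
by the finite type.
\<close>

lemma nn_integral_lborel_vec_prod:
  fixes g :: "'n::finite \<Rightarrow> real \<Rightarrow> ennreal"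
  assumes [measurable]: "\<And>i. g i \<in> borel_measurable borel"
  shows "(\<integral>\<^sup>+z. (\<Prod>i\<in>UNIV. g i (z $ i)) \<partial>(lborel :: (real^'n) measure)) = (\<Prod>i\<in>UNIV. \<integral>\<^sup>+x. g i x \<partial>lborel)"
proof -
  have B: "(Basis :: (real^'n) set) = range (\<lambda>i. axis i 1)"
    by (auto simp: Basis_vec_def)
  have inj: "inj (\<lambda>i. axis i 1 :: real^'n)"
    by (auto simp: inj_def axis_eq_axis)
  have "(\<integral>\<^sup>+z. (\<Prod>b\<in>Basis. g (axis_index b) (z \<bullet> b)) \<partial>(lborel :: (real^'n) measure))
      = (\<Prod>b\<in>(Basis :: (real^'n) set). \<integral>\<^sup>+x. g (axis_index b) x \<partial>lborel)"
    by (rule nn_integral_lborel_prod) auto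
  then show ?thesis
    unfolding B prod.reindex[OF inj] by (simp add: o_def inner_axis axis_index_axis)
qed

lemma measurable_coordinates [measurable]:
  "(\<lambda>z::real^'n. \<lambda>i\<in>UNIV. z $ i) \<in> measurable borel (\<Pi>\<^sub>M i\<in>(UNIV::'n set). borel)"
  by (intro measurable_restrict) simp

text \<open>
The density of the standard normal law is a product over the coordinates, hence the coordinates are
independent standard normal variables. Both measures are compared on rectangles.
\<close>

lemma std_gaussian_coordinates:
  "distr (std_gaussian :: (real^'n) measure) (\<Pi>\<^sub>M i\<in>(UNIV::'n set). borel) (\<lambda>z. \<lambda>i\<in>UNIV. z $ i)
     = (\<Pi>\<^sub>M i\<in>(UNIV::'n set). std_normal_distribution)"
proof -
  interpret N: prob_space std_normal_distribution
    by (simp add: prob_space_normal_density)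
  interpret product_prob_space "\<lambda>_::'n. std_normal_distribution" UNIV ..
  let ?D = "distr (std_gaussian :: (real^'n) measure) (\<Pi>\<^sub>M i\<in>(UNIV::'n set). borel) (\<lambda>z. \<lambda>i\<in>UNIV. z $ i)"
  show ?thesis
  proof (rule PiM_eqI)
    show "sets ?D = sets (\<Pi>\<^sub>M i\<in>(UNIV::'n set). std_normal_distribution)"
      by (auto intro!: sets_PiM_cong)
    fix A :: "'n \<Rightarrow> real set" assume "\<And>i. i \<in> UNIV \<Longrightarrow> A i \<in> sets std_normal_distribution"
    then have [measurable]: "A i \<in> sets borel" for i by simp
    have PiA: "Pi\<^sub>E UNIV A \<in> sets (\<Pi>\<^sub>M i\<in>(UNIV::'n set). borel)"
      by (intro sets_PiM_I_finite) auto
    have rect: "(\<lambda>z::real^'n. \<lambda>i\<in>UNIV. z $ i) -` Pi\<^sub>E UNIV A = {z. \<forall>i. z $ i \<in> A i}"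
      by auto
    have meas: "{z::real^'n. \<forall>i. z $ i \<in> A i} \<in> sets borel"
      by measurable
    have "emeasure ?D (Pi\<^sub>E UNIV A) = emeasure std_gaussian {z::real^'n. \<forall>i. z $ i \<in> A i}"
      by (subst emeasure_distr) (auto simp: std_gaussian_def PiA rect)
    also have "\<dots> = (\<integral>\<^sup>+z. ennreal (\<Prod>i\<in>UNIV. std_normal_density (z $ i)) *
        indicator {z::real^'n. \<forall>i. z $ i \<in> A i} z \<partial>lborel)"
      unfolding std_gaussian_def by (subst emeasure_density) (auto simp: meas)
    also have "\<dots> = (\<integral>\<^sup>+z. (\<Prod>i\<in>UNIV. ennreal (std_normal_density (z $ i)) * indicator (A i) (z $ i))
        \<partial>(lborel :: (real^'n) measure))"
    proof (rule nn_integral_cong)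
      fix z :: "real^'n"
      have "(indicator {z::real^'n. \<forall>i. z $ i \<in> A i} z :: ennreal) = (\<Prod>i\<in>UNIV. indicator (A i) (z $ i))"
        by (cases "\<forall>i. z $ i \<in> A i") (auto simp: indicator_def intro!: prod_zero[symmetric])
      then show "ennreal (\<Prod>i\<in>UNIV. std_normal_density (z $ i)) * indicator {z::real^'n. \<forall>i. z $ i \<in> A i} z
          = (\<Prod>i\<in>UNIV. ennreal (std_normal_density (z $ i)) * indicator (A i) (z $ i))"
        by (simp add: prod.distrib prod_ennreal)
    qed
    also have "\<dots> = (\<Prod>i\<in>(UNIV::'n set). \<integral>\<^sup>+x. ennreal (std_normal_density x) * indicator (A i) x \<partial>lborel)"
      by (rule nn_integral_lborel_vec_prod) simp
    also have "\<dots> = (\<Prod>i\<in>UNIV. emeasure std_normal_distribution (A i))"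
      by (intro prod.cong refl) (simp add: emeasure_density)
    finally show "emeasure ?D (Pi\<^sub>E UNIV A) = (\<Prod>i\<in>UNIV. emeasure std_normal_distribution (A i))" .
  qed simp
qed

lemma sets_std_gaussian [measurable_cong, simp]: "sets std_gaussian = sets borel"
  by (simp add: std_gaussian_def)

lemma space_std_gaussian [simp]: "space std_gaussian = UNIV"
  by (simp add: std_gaussian_def)

lemma prob_space_std_gaussian: "prob_space (std_gaussian :: (real^'n) measure)"
proof (rule prob_space_distrD)
  show "(\<lambda>z. \<lambda>i\<in>UNIV. z $ i) \<in> measurable (std_gaussian :: (real^'n) measure) (\<Pi>\<^sub>M i\<in>(UNIV::'n set). borel)"
    by measurable
  show "prob_space (distr (std_gaussian :: (real^'n) measure) (\<Pi>\<^sub>M i\<in>(UNIV::'n set). borel) (\<lambda>z. \<lambda>i\<in>UNIV. z $ i))"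
    unfolding std_gaussian_coordinates
    by (intro prob_space_PiM) (simp add: prob_space_normal_density)
qed

lemma distr_std_gaussian_coordinate:
  "distr (std_gaussian :: (real^'n) measure) borel (\<lambda>z. z $ i) = std_normal_distribution"
proof -
  have "distr (std_gaussian :: (real^'n) measure) borel (\<lambda>z. z $ i)
      = distr (distr std_gaussian (\<Pi>\<^sub>M i\<in>(UNIV::'n set). borel) (\<lambda>z::real^'n. \<lambda>i\<in>UNIV. z $ i)) borel (\<lambda>f. f i)"
    by (subst distr_distr) (auto simp: o_def)
  also have "\<dots> = distr (\<Pi>\<^sub>M i\<in>(UNIV::'n set). std_normal_distribution) std_normal_distribution (\<lambda>f. f i)"
    unfolding std_gaussian_coordinates by (intro distr_cong) auto
  also have "\<dots> = std_normal_distribution"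
    by (subst distr_PiM_component) (auto simp: prob_space_normal_density)
  finally show ?thesis .
qed

lemma indep_std_gaussian_coordinates:
  "prob_space.indep_vars std_gaussian (\<lambda>_. borel) (\<lambda>i z. (z :: real^'n) $ i) UNIV"
  using std_gaussian_coordinates[where 'n='n]
  by (subst prob_space.indep_vars_iff_distr_eq_PiM'[OF prob_space_std_gaussian])
    (auto simp: distr_std_gaussian_coordinate)

lemma std_gaussian_linear_form:
  fixes a :: "real^'n"
  shows "centred_gaussian std_gaussian (\<lambda>z. a \<bullet> z)" "(\<integral>z. (a \<bullet> z)\<^sup>2 \<partial>std_gaussian) = a \<bullet> a"
proof -
  interpret prob_space "std_gaussian :: (real^'n) measure" by (rule prob_space_std_gaussian)
  have coord: "centred_gaussian std_gaussian (\<lambda>z::real^'n. z $ i)" for i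
    using centred_gaussian_std_normal unfolding distr_std_gaussian_coordinate[of i, symmetric]
    by (rule centred_gaussian_distr[rotated]) simp
  have sq: "(\<integral>z. (a $ i * z $ i)\<^sup>2 \<partial>(std_gaussian :: (real^'n) measure)) = a $ i * a $ i" for i
  proof -
    have "1 = (\<integral>x. x\<^sup>2 \<partial>distr (std_gaussian :: (real^'n) measure) borel (\<lambda>z. z $ i))"
      unfolding distr_std_gaussian_coordinate by (rule second_moment_std_normal[symmetric])
    then have "(\<integral>z. (z $ i)\<^sup>2 \<partial>(std_gaussian :: (real^'n) measure)) = 1"
      by (subst (asm) integral_distr) auto
    then show ?thesis unfolding power_mult_distrib by (simp add: power2_eq_square[of "a $ i"])
  qed
  have "indep_vars (\<lambda>_. borel) (\<lambda>i z::real^'n. a $ i * z $ i) UNIV"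
    by (rule indep_vars_compose2[OF indep_std_gaussian_coordinates, of "\<lambda>i x. a $ i * x"]) auto
  from centred_gaussian_sum_indep[OF _ this] coord
  show "centred_gaussian std_gaussian (\<lambda>z. a \<bullet> z)" "(\<integral>z. (a \<bullet> z)\<^sup>2 \<partial>std_gaussian) = a \<bullet> a"
    by (auto simp: inner_vec_def centred_gaussian_scale sq)
qed

section \<open>Uniqueness of characteristic functions in Euclidean space\<close>

lemma iexp_std_gaussian:
  fixes t :: "real^'n"
  shows "(\<integral>z. iexp (t \<bullet> z) \<partial>std_gaussian) = complex_of_real (exp (- (t \<bullet> t) / 2))"
  using centred_gaussianD(4)[OF std_gaussian_linear_form(1)[of t], of 1]
  by (subst (asm) char_distr) (simp_all add: std_gaussian_linear_form(2))

text \<open>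
A Gaussian kernel is a superposition of characters: it is the characteristic function of a
standard normal vector $z$. By Fubini, the integral of a kernel with arbitrary centre $y$ against $\mu$ is
computed from the characteristic function of $\mu$ alone.
\<close>

lemma gaussian_kernel_integral_from_char:
  fixes \<mu> :: "(real^'n) measure"
  assumes "prob_space \<mu>" and [measurable_cong]: "sets \<mu> = sets borel"
  shows "complex_of_real (\<integral>x. exp (- ((c *\<^sub>R (x - y)) \<bullet> (c *\<^sub>R (x - y))) / 2) \<partial>\<mu>)
    = (\<integral>z. iexp (- ((c *\<^sub>R z) \<bullet> y)) * (\<integral>x. iexp ((c *\<^sub>R z) \<bullet> x) \<partial>\<mu>) \<partial>std_gaussian)"
proof -
  interpret M: prob_space \<mu> by fact
  interpret G: prob_space "std_gaussian :: (real^'n) measure" by (rule prob_space_std_gaussian)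
  interpret pair_prob_space \<mu> "std_gaussian :: (real^'n) measure" ..
  have "complex_of_real (\<integral>x. exp (- ((c *\<^sub>R (x - y)) \<bullet> (c *\<^sub>R (x - y))) / 2) \<partial>\<mu>)
      = (\<integral>x. (\<integral>z. iexp ((c *\<^sub>R (x - y)) \<bullet> z) \<partial>std_gaussian) \<partial>\<mu>)"
    by (simp only: iexp_std_gaussian integral_complex_of_real)
  also have "\<dots> = (\<integral>z. (\<integral>x. iexp ((c *\<^sub>R (x - y)) \<bullet> z) \<partial>\<mu>) \<partial>std_gaussian)"
    by (rule Fubini_integral[symmetric], rule P.integrable_const_bound[of _ 1]) auto
  also have "\<dots> = (\<integral>z. (\<integral>x. iexp (- ((c *\<^sub>R z) \<bullet> y)) * iexp ((c *\<^sub>R z) \<bullet> x) \<partial>\<mu>) \<partial>std_gaussian)"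
    by (intro Bochner_Integration.integral_cong refl)
      (simp add: inner_commute inner_diff_left inner_diff_right right_diff_distrib algebra_simps flip: exp_add)
  finally show ?thesis by simp
qed

lemma std_gaussian_density_eq:
  fixes z :: "real^'n"
  shows "(\<Prod>i\<in>UNIV. std_normal_density (z $ i)) = (1 / sqrt (2 * pi)) ^ CARD('n) * exp (- (z \<bullet> z) / 2)"
proof -
  have "(\<Prod>i\<in>UNIV. exp (- (z $ i)\<^sup>2 / 2)) = exp (- (z \<bullet> z) / 2)"
    by (simp add: inner_vec_def power2_eq_square sum_negf flip: exp_sum sum_divide_distrib)
  then show ?thesis
    unfolding std_normal_density_def prod.distrib by simp
qed

text \<open>
The convolution of $\mu$ with the law of $s z$ has the density $y \mapsto s^{-n} \int \rho((y - x)/s) \, d\mu(x)$, where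
$\rho$ is the standard normal density. By the preceding lemma this density depends on $\mu$ only through its
characteristic function. The power of $s$ is kept on the left so that no division occurs.
\<close>

lemma nn_integral_gaussian_smoothing:
  fixes \<mu> :: "(real^'n) measure" and g :: "real^'n \<Rightarrow> ennreal"
  assumes "prob_space \<mu>" and [measurable_cong]: "sets \<mu> = sets borel"
    and [measurable]: "g \<in> borel_measurable borel" and s: "0 < s"
  shows "ennreal (s ^ CARD('n)) * (\<integral>\<^sup>+x. (\<integral>\<^sup>+z. g (x + s *\<^sub>R z) \<partial>std_gaussian) \<partial>\<mu>)
    = (\<integral>\<^sup>+y. ennreal ((1 / sqrt (2 * pi)) ^ CARD('n)
        * (\<integral>x. exp (- (((1 / s) *\<^sub>R (x - y)) \<bullet> ((1 / s) *\<^sub>R (x - y))) / 2) \<partial>\<mu>)) * g y \<partial>lborel)"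
proof -
  interpret M: prob_space \<mu> by fact
  interpret pair_sigma_finite \<mu> "lborel :: (real^'n) measure" ..
  define c where "c = (1 / sqrt (2 * pi)) ^ CARD('n)"
  have c: "0 \<le> c" by (simp add: c_def)
  define \<rho> where "\<rho> z = ennreal (c * exp (- (z \<bullet> z) / 2))" for z :: "real^'n"
  have [measurable]: "\<rho> \<in> borel_measurable borel" unfolding \<rho>_def by measurable
  have G: "std_gaussian = density lborel \<rho>"
    unfolding std_gaussian_def \<rho>_def c_def std_gaussian_density_eq ..
  \<comment> \<open>substitution $y = x + s z$\<close>
  have smooth: "ennreal (s ^ CARD('n)) * (\<integral>\<^sup>+z. g (x + s *\<^sub>R z) \<partial>std_gaussian)
      = (\<integral>\<^sup>+y. \<rho> ((1 / s) *\<^sub>R (y - x)) * g y \<partial>lborel)" for x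
  proof -
    have "(\<integral>\<^sup>+y. \<rho> ((1 / s) *\<^sub>R (y - x)) * g y \<partial>lborel)
        = (\<integral>\<^sup>+y. ennreal (s ^ CARD('n)) * (\<rho> ((1 / s) *\<^sub>R (y - x)) * g y) \<partial>distr lborel borel (\<lambda>z. x + s *\<^sub>R z))"
      using s by (subst lborel_affine[of s x]) (auto simp: nn_integral_density)
    also have "\<dots> = (\<integral>\<^sup>+z. ennreal (s ^ CARD('n)) * (\<rho> z * g (x + s *\<^sub>R z)) \<partial>lborel)"
      using s by (subst nn_integral_distr) auto
    finally show ?thesis
      unfolding G by (simp add: nn_integral_density nn_integral_cmult)
  qed
  have kernel: "(\<integral>\<^sup>+x. \<rho> ((1 / s) *\<^sub>R (y - x)) \<partial>\<mu>)
      = ennreal (c * (\<integral>x. exp (- (((1 / s) *\<^sub>R (x - y)) \<bullet> ((1 / s) *\<^sub>R (x - y))) / 2) \<partial>\<mu>))" for y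
  proof -
    have "((1 / s) *\<^sub>R (y - x)) \<bullet> ((1 / s) *\<^sub>R (y - x)) = ((1 / s) *\<^sub>R (x - y)) \<bullet> ((1 / s) *\<^sub>R (x - y))" for x
      by (simp add: inner_diff_left inner_diff_right algebra_simps)
    then have "(\<integral>\<^sup>+x. \<rho> ((1 / s) *\<^sub>R (y - x)) \<partial>\<mu>)
        = (\<integral>\<^sup>+x. ennreal (c * exp (- (((1 / s) *\<^sub>R (x - y)) \<bullet> ((1 / s) *\<^sub>R (x - y))) / 2)) \<partial>\<mu>)"
      unfolding \<rho>_def by presburger
    also have "\<dots> = ennreal (\<integral>x. c * exp (- (((1 / s) *\<^sub>R (x - y)) \<bullet> ((1 / s) *\<^sub>R (x - y))) / 2) \<partial>\<mu>)"
    proof (rule nn_integral_eq_integral)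
      show "integrable \<mu> (\<lambda>x. c * exp (- (((1 / s) *\<^sub>R (x - y)) \<bullet> ((1 / s) *\<^sub>R (x - y))) / 2))"
        using c by (intro integrable_mult_right M.integrable_const_bound[of _ 1]) auto
    qed (use c in auto)
    finally show ?thesis by simp
  qed
  have "ennreal (s ^ CARD('n)) * (\<integral>\<^sup>+x. (\<integral>\<^sup>+z. g (x + s *\<^sub>R z) \<partial>std_gaussian) \<partial>\<mu>)
      = (\<integral>\<^sup>+x. ennreal (s ^ CARD('n)) * (\<integral>\<^sup>+z. g (x + s *\<^sub>R z) \<partial>std_gaussian) \<partial>\<mu>)"
    by (subst nn_integral_cmult) (auto simp: G nn_integral_density)
  also have "\<dots> = (\<integral>\<^sup>+x. (\<integral>\<^sup>+y. \<rho> ((1 / s) *\<^sub>R (y - x)) * g y \<partial>lborel) \<partial>\<mu>)"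
    unfolding smooth ..
  also have "\<dots> = (\<integral>\<^sup>+y. (\<integral>\<^sup>+x. \<rho> ((1 / s) *\<^sub>R (y - x)) * g y \<partial>\<mu>) \<partial>lborel)"
    by (rule Fubini'[symmetric]) measurable
  also have "\<dots> = (\<integral>\<^sup>+y. (\<integral>\<^sup>+x. \<rho> ((1 / s) *\<^sub>R (y - x)) \<partial>\<mu>) * g y \<partial>lborel)"
    by (intro nn_integral_cong nn_integral_multc) measurable
  finally show ?thesis unfolding kernel c_def .
qed

text \<open>
On the product space the integrands converge pointwise by continuity of $g$ and are dominated by $1$.
\<close>

lemma smoothing_tendsto:
  fixes \<mu> :: "(real^'n) measure" and g :: "real^'n \<Rightarrow> real"
  assumes "prob_space \<mu>" and [measurable_cong]: "sets \<mu> = sets borel"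
    and g: "continuous_on UNIV g" "\<And>x. 0 \<le> g x" "\<And>x. g x \<le> 1"
  shows "(\<lambda>k. \<integral>\<^sup>+x. (\<integral>\<^sup>+z. ennreal (g (x + (1 / real (Suc k)) *\<^sub>R z)) \<partial>std_gaussian) \<partial>\<mu>)
     \<longlonglongrightarrow> ennreal (\<integral>x. g x \<partial>\<mu>)"
proof -
  interpret M: prob_space \<mu> by fact
  interpret G: prob_space "std_gaussian :: (real^'n) measure" by (rule prob_space_std_gaussian)
  interpret pair_prob_space \<mu> "std_gaussian :: (real^'n) measure" ..
  have [measurable]: "g \<in> borel_measurable borel"
    using g(1) by (rule borel_measurable_continuous_onI)
  let ?P = "\<mu> \<Otimes>\<^sub>M (std_gaussian :: (real^'n) measure)"
  let ?f = "\<lambda>k p. g (fst p + (1 / real (Suc k)) *\<^sub>R snd p)"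
  have lim: "(\<lambda>k. \<integral>p. ?f k p \<partial>?P) \<longlonglongrightarrow> (\<integral>p. g (fst p) \<partial>?P)"
  proof (rule integral_dominated_convergence[where w = "\<lambda>_. 1"])
    show "AE p in ?P. (\<lambda>k. ?f k p) \<longlonglongrightarrow> g (fst p)"
    proof (intro AE_I2)
      fix p :: "(real^'n) \<times> (real^'n)"
      have "(\<lambda>k. fst p + (1 / real (Suc k)) *\<^sub>R snd p) \<longlonglongrightarrow> fst p + 0 *\<^sub>R snd p"
        by (intro tendsto_intros LIMSEQ_Suc[OF lim_1_over_n])
      then show "(\<lambda>k. ?f k p) \<longlonglongrightarrow> g (fst p)"
        using g(1) by (auto simp: continuous_on_eq_continuous_at intro: isCont_tendsto_compose)
    qed
  qed (use g in auto)
  have "(\<integral>\<^sup>+x. (\<integral>\<^sup>+z. ennreal (g (x + (1 / real (Suc k)) *\<^sub>R z)) \<partial>std_gaussian) \<partial>\<mu>)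
      = ennreal (\<integral>p. ?f k p \<partial>?P)" for k
  proof -
    have "(\<integral>\<^sup>+x. (\<integral>\<^sup>+z. ennreal (g (x + (1 / real (Suc k)) *\<^sub>R z)) \<partial>std_gaussian) \<partial>\<mu>)
      = (\<integral>\<^sup>+p. ennreal (?f k p) \<partial>?P)"
      by (subst G.nn_integral_fst[symmetric]) (auto simp: case_prod_beta)
    also have "\<dots> = ennreal (\<integral>p. ?f k p \<partial>?P)"
      using g by (intro nn_integral_eq_integral P.integrable_const_bound[of _ 1]) auto
    finally show ?thesis .
  qed
  moreover have "(\<integral>p. g (fst p) \<partial>?P) = (\<integral>x. g x \<partial>\<mu>)"
  proof -
    have "(\<integral>p. g (fst p) \<partial>?P)
        = (\<integral>x. g x \<partial>distr ?P \<mu> fst)"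
      by (subst integral_distr) auto
    then show ?thesis by (simp add: G.distr_pair_fst)
  qed
  ultimately show ?thesis using lim by simp
qed

text \<open>
The closed sets generate the Borel sets and are stable under intersection, and the indicator of a closed
set is a pointwise limit of the continuous functions $\max(0, 1 - k \, d(x, C))$.
\<close>

lemma measure_eqI_continuous:
  fixes \<mu> \<nu> :: "'a::metric_space measure"
  assumes "prob_space \<mu>" and [measurable_cong]: "sets \<mu> = sets borel"
    and "prob_space \<nu>" and [measurable_cong]: "sets \<nu> = sets borel"
    and eq: "\<And>g :: 'a \<Rightarrow> real. continuous_on UNIV g \<Longrightarrow> (\<And>x. 0 \<le> g x) \<Longrightarrow> (\<And>x. g x \<le> 1)
      \<Longrightarrow> (\<integral>x. g x \<partial>\<mu>) = (\<integral>x. g x \<partial>\<nu>)"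
  shows "\<mu> = \<nu>"
proof -
  interpret M: prob_space \<mu> by fact
  interpret N: prob_space \<nu> by fact
  have closed: "emeasure \<mu> C = emeasure \<nu> C" if C: "closed C" for C
  proof (cases "C = {}")
    case False
    define g where "g k x = max 0 (1 - real k * infdist x C)" for k :: nat and x
    have cont: "continuous_on UNIV (g k)" for k
      unfolding g_def by (intro continuous_intros)
    then have [measurable]: "g k \<in> borel_measurable borel" for k
      by (rule borel_measurable_continuous_onI)
    have bnd: "0 \<le> g k x" "g k x \<le> 1" for k x
      by (auto simp: g_def infdist_nonneg)
    have ptw: "(\<lambda>k. g k x) \<longlonglongrightarrow> indicator C x" for x
    proof (cases "x \<in> C")
      case True
      then show ?thesis by (simp add: g_def)
    next
      case x: False
      then have pos: "0 < infdist x C"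
        using C False by (metis in_closed_iff_infdist_zero infdist_nonneg less_eq_real_def)
      obtain n where n: "1 / infdist x C \<le> real n" using real_arch_simple by blast
      \<comment> \<open>off $C$ the approximating functions vanish eventually, the distance to $C$ being positive\<close>
      have "g k x = 0" if "n \<le> k" for k
      proof -
        have "1 / infdist x C \<le> real k" using n that by linarith
        then show ?thesis using pos by (simp add: g_def field_simps)
      qed
      then have "eventually (\<lambda>k. g k x = indicator C x) sequentially"
        using x by (auto simp: eventually_sequentially)
      then show ?thesis by (rule tendsto_eventually)
    qed
    have [measurable]: "C \<in> sets borel" using C by (rule borel_closed)
    have lim: "(\<lambda>k. \<integral>x. g k x \<partial>\<rho>) \<longlonglongrightarrow> measure \<rho> C"
      if \<rho>: "prob_space \<rho>" and [measurable_cong]: "sets \<rho> = sets borel" for \<rho>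
    proof -
      interpret prob_space \<rho> by fact
      have "(\<lambda>k. \<integral>x. g k x \<partial>\<rho>) \<longlonglongrightarrow> (\<integral>x. indicator C x \<partial>\<rho>)"
        by (rule integral_dominated_convergence[where w = "\<lambda>_. 1"]) (use ptw bnd in auto)
      moreover have "C \<inter> space \<rho> = C"
        using sets_eq_imp_space_eq[OF that(2)] by simp
      ultimately show ?thesis by simp
    qed
    have "measure \<mu> C = measure \<nu> C"
      using lim[of \<mu>] lim[of \<nu>] assms(1-4) LIMSEQ_unique
      by (auto simp: eq[OF cont bnd])
    then show ?thesis by (simp add: M.emeasure_eq_measure N.emeasure_eq_measure)
  qed simp
  show ?thesis
  proof (rule measure_eqI_generator_eq[where E = "Collect closed" and \<Omega> = UNIV and A = "\<lambda>_. UNIV"])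
    show "Int_stable (Collect closed :: 'a set set)" by (auto simp: Int_stable_def)
    show "sets \<mu> = sigma_sets UNIV (Collect closed)" "sets \<nu> = sigma_sets UNIV (Collect closed)"
      using assms by (simp_all add: borel_eq_closed)
  qed (auto intro: closed)
qed

text \<open>
Equal characteristic functions give equal Gaussian smoothings at every width $s > 0$; let $s \to 0$.
\<close>

lemma measure_eqI_char:
  fixes \<mu> \<nu> :: "(real^'n) measure"
  assumes "prob_space \<mu>" "sets \<mu> = sets borel" "prob_space \<nu>" "sets \<nu> = sets borel"
    and eq: "\<And>t. (\<integral>x. iexp (t \<bullet> x) \<partial>\<mu>) = (\<integral>x. iexp (t \<bullet> x) \<partial>\<nu>)"
  shows "\<mu> = \<nu>"
proof (rule measure_eqI_continuous)
  fix g :: "real^'n \<Rightarrow> real"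
  assume g: "continuous_on UNIV g" "\<And>x. 0 \<le> g x" "\<And>x. g x \<le> 1"
  then have [measurable]: "g \<in> borel_measurable borel"
    by (intro borel_measurable_continuous_onI)
  have kernel: "(\<integral>x. exp (- ((c *\<^sub>R (x - y)) \<bullet> (c *\<^sub>R (x - y))) / 2) \<partial>\<mu>)
      = (\<integral>x. exp (- ((c *\<^sub>R (x - y)) \<bullet> (c *\<^sub>R (x - y))) / 2) \<partial>\<nu>)" for c y
    using gaussian_kernel_integral_from_char[OF assms(1,2), of c y]
      gaussian_kernel_integral_from_char[OF assms(3,4), of c y]
    unfolding eq of_real_eq_iff[where 'a = complex, symmetric] by simp
  have "(\<integral>\<^sup>+x. (\<integral>\<^sup>+z. ennreal (g (x + s *\<^sub>R z)) \<partial>std_gaussian) \<partial>\<mu>)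
      = (\<integral>\<^sup>+x. (\<integral>\<^sup>+z. ennreal (g (x + s *\<^sub>R z)) \<partial>std_gaussian) \<partial>\<nu>)" if "0 < s" for s
  proof -
    have gm: "(\<lambda>x. ennreal (g x)) \<in> borel_measurable borel" by measurable
    have "ennreal (s ^ CARD('n)) * (\<integral>\<^sup>+x. (\<integral>\<^sup>+z. ennreal (g (x + s *\<^sub>R z)) \<partial>std_gaussian) \<partial>\<mu>)
      = ennreal (s ^ CARD('n)) * (\<integral>\<^sup>+x. (\<integral>\<^sup>+z. ennreal (g (x + s *\<^sub>R z)) \<partial>std_gaussian) \<partial>\<nu>)"
      unfolding nn_integral_gaussian_smoothing[OF assms(1,2) gm that]
        nn_integral_gaussian_smoothing[OF assms(3,4) gm that] kernel ..
    then show ?thesis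
      using that by (simp add: ennreal_mult_cancel_left)
  qed
  then have "ennreal (\<integral>x. g x \<partial>\<mu>) = ennreal (\<integral>x. g x \<partial>\<nu>)"
    using smoothing_tendsto[OF assms(1,2) g] smoothing_tendsto[OF assms(3,4) g]
    by (simp add: LIMSEQ_unique)
  then show "(\<integral>x. g x \<partial>\<mu>) = (\<integral>x. g x \<partial>\<nu>)"
    using g(2) by (simp add: ennreal_inj)
qed fact+

section \<open>Gaussian spaces and cross-covariances\<close>

lemma matrix_eq_bilinear:
  fixes M M' :: "real^'l^'k"
  assumes "\<And>s t. s \<bullet> (M *v t) = s \<bullet> (M' *v t)"
  shows "M = M'"
proof -
  have "M *v t = M' *v t" for t
    using vector_eq_ldot[of "M *v t" "M' *v t"] assms by simp
  then show ?thesis by (simp add: matrix_eq)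
qed

lemma inner_matrix_vector: "s \<bullet> (K *v x) = (transpose K *v s) \<bullet> (x :: real^'l)" for K :: "real^'l^'k"
  by (simp only: transpose_matrix_vector dot_lmul_matrix)

text \<open>
The cross-covariance $E[X Y^T]$ of vectors with mean zero; no means are subtracted.
\<close>

definition xcov :: "'a measure \<Rightarrow> ('a \<Rightarrow> real^'k) \<Rightarrow> ('a \<Rightarrow> real^'l) \<Rightarrow> real^'l^'k" where
  "xcov P X Y = (\<chi> i j. \<integral>\<omega>. X \<omega> $ i * Y \<omega> $ j \<partial>P)"

lemma transpose_xcov: "transpose (xcov P X Y) = xcov P Y X"
  by (simp add: xcov_def transpose_def mult.commute)

text \<open>
Projections instead of a space of vectors let random vectors of different dimensions, such as states
and inputs, share one space $G$ of scalar random variables.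
\<close>

definition vec_over :: "('a \<Rightarrow> real) set \<Rightarrow> ('a \<Rightarrow> real^'k) \<Rightarrow> bool" where
  "vec_over G X \<longleftrightarrow> (\<forall>t. (\<lambda>\<omega>. t \<bullet> X \<omega>) \<in> G)"

text \<open>
Vectors over such a space are automatically jointly Gaussian, since every linear combination of their
coordinates is an element of $G$. Linear feedback keeps the deviations from the means inside the space.
\<close>

locale gaussian_space = prob_space P for P :: "'a measure" +
  fixes G :: "('a \<Rightarrow> real) set"
  assumes centred: "f \<in> G \<Longrightarrow> centred_gaussian P f"
    and zero: "(\<lambda>_. 0) \<in> G"
    and add: "f \<in> G \<Longrightarrow> g \<in> G \<Longrightarrow> (\<lambda>\<omega>. f \<omega> + g \<omega>) \<in> G"
    and scale: "f \<in> G \<Longrightarrow> (\<lambda>\<omega>. c * f \<omega>) \<in> G"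
begin

lemma vec_over_add:
  "vec_over G X \<Longrightarrow> vec_over G Y \<Longrightarrow> vec_over G (\<lambda>\<omega>. X \<omega> + Y \<omega>)"
  by (simp add: vec_over_def inner_add_right add)

lemma vec_over_zero: "vec_over G (\<lambda>_. 0)"
  by (simp add: vec_over_def zero)

lemma vec_over_sum:
  "(\<And>i. i \<in> I \<Longrightarrow> vec_over G (X i)) \<Longrightarrow> vec_over G (\<lambda>\<omega>. \<Sum>i\<in>I. X i \<omega>)"
  by (induction I rule: infinite_finite_induct) (simp_all add: vec_over_zero vec_over_add)

lemma vec_over_matrix: "vec_over G X \<Longrightarrow> vec_over G (\<lambda>\<omega>. K *v X \<omega>)"
  unfolding vec_over_def inner_matrix_vector by blast

lemma vec_over_diff:
  assumes "vec_over G X" "vec_over G Y" shows "vec_over G (\<lambda>\<omega>. X \<omega> - Y \<omega>)"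
  unfolding vec_over_def
proof
  fix t
  have "(\<lambda>\<omega>. t \<bullet> X \<omega> + (- 1) * (t \<bullet> Y \<omega>)) \<in> G"
    using assms by (intro add scale) (auto simp: vec_over_def)
  then show "(\<lambda>\<omega>. t \<bullet> (X \<omega> - Y \<omega>)) \<in> G"
    by (simp add: inner_diff_right)
qed

lemma vec_over_inner:
  assumes "vec_over G X"
  shows "(\<lambda>\<omega>. t \<bullet> X \<omega>) \<in> borel_measurable P" "integrable P (\<lambda>\<omega>. (t \<bullet> X \<omega>)\<^sup>2)"
    "integrable P (\<lambda>\<omega>. t \<bullet> X \<omega>)" "(\<integral>\<omega>. t \<bullet> X \<omega> \<partial>P) = 0"
    "(\<integral>\<omega>. iexp (t \<bullet> X \<omega>) \<partial>P) = complex_of_real (exp (- (\<integral>\<omega>. (t \<bullet> X \<omega>)\<^sup>2 \<partial>P) / 2))"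
proof -
  have cg: "centred_gaussian P (\<lambda>\<omega>. t \<bullet> X \<omega>)"
    using assms by (intro centred) (simp add: vec_over_def)
  note * = centred_gaussianD[OF cg]
  show "(\<lambda>\<omega>. t \<bullet> X \<omega>) \<in> borel_measurable P" "integrable P (\<lambda>\<omega>. (t \<bullet> X \<omega>)\<^sup>2)"
    "(\<integral>\<omega>. t \<bullet> X \<omega> \<partial>P) = 0" by (rule *)+
  then show "integrable P (\<lambda>\<omega>. t \<bullet> X \<omega>)" by (simp add: integrable_of_square)
  show "(\<integral>\<omega>. iexp (t \<bullet> X \<omega>) \<partial>P) = complex_of_real (exp (- (\<integral>\<omega>. (t \<bullet> X \<omega>)\<^sup>2 \<partial>P) / 2))"
    using *(1) *(4)[of 1] by (simp add: char_distr)
qed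

lemma vec_over_measurable:
  assumes "vec_over G X" shows "X \<in> borel_measurable P"
  unfolding borel_measurable_euclidean_space[of X]
  using vec_over_inner(1)[OF assms] by (simp add: inner_commute)

lemma vec_over_component_measurable:
  assumes "vec_over G X" shows "(\<lambda>\<omega>. X \<omega> $ i) \<in> borel_measurable P"
  using vec_over_inner(1)[OF assms, of "axis i 1"] by (simp add: inner_axis')

lemma vec_over_integrable:
  assumes "vec_over G X" shows "integrable P X"
proof -
  have "integrable P (\<lambda>\<omega>. X \<omega> \<bullet> b)" for b
    using vec_over_inner(3)[OF assms, of b] by (simp only: inner_commute)
  then have "integrable P (\<lambda>\<omega>. (X \<omega> \<bullet> b) *\<^sub>R b)" for b
    by (rule integrable_scaleR_left)
  then have "integrable P (\<lambda>\<omega>. \<Sum>b\<in>Basis. (X \<omega> \<bullet> b) *\<^sub>R b)"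
    by (intro Bochner_Integration.integrable_sum)
  then show ?thesis by (simp only: euclidean_representation)
qed

lemma vec_over_mean_zero:
  assumes "vec_over G X" shows "integral\<^sup>L P X = 0"
proof -
  have "t \<bullet> integral\<^sup>L P X = t \<bullet> 0" for t
    using vec_over_inner(4)[OF assms, of t] vec_over_integrable[OF assms] by simp
  then show ?thesis using vector_eq_ldot[of "integral\<^sup>L P X" 0] by simp
qed

lemma vec_over_mean:
  assumes "vec_over G X" shows "(\<integral>\<omega>. m + X \<omega> \<partial>P) = m"
  using vec_over_integrable[OF assms] vec_over_mean_zero[OF assms] by (simp add: prob_space)

lemma vec_over_integrable_products:
  assumes "vec_over G X" "vec_over G Y"
  shows "integrable P (\<lambda>\<omega>. (s \<bullet> X \<omega>) * (t \<bullet> Y \<omega>))"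
  using vec_over_inner(1,2)[OF assms(1)] vec_over_inner(1,2)[OF assms(2)]
  by (intro integrable_mult_of_squares)

text \<open>
Matrix identities for cross-covariances reduce through this formula to the linearity of the scalar
projections.
\<close>

lemma xcov_bilinear:
  fixes X :: "'a \<Rightarrow> real^'k" and Y :: "'a \<Rightarrow> real^'l"
  assumes "vec_over G X" "vec_over G Y"
  shows "s \<bullet> (xcov P X Y *v t) = (\<integral>\<omega>. (s \<bullet> X \<omega>) * (t \<bullet> Y \<omega>) \<partial>P)"
proof -
  have int: "integrable P (\<lambda>\<omega>. X \<omega> $ i * Y \<omega> $ j)" for i j
    using vec_over_integrable_products[OF assms, of "axis i 1" "axis j 1"] by (simp add: inner_axis')
  have "(\<integral>\<omega>. (s \<bullet> X \<omega>) * (t \<bullet> Y \<omega>) \<partial>P)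
      = (\<integral>\<omega>. (\<Sum>i\<in>UNIV. \<Sum>j\<in>UNIV. (s $ i * t $ j) * (X \<omega> $ i * Y \<omega> $ j)) \<partial>P)"
    by (intro Bochner_Integration.integral_cong refl) (simp add: inner_vec_def sum_product ac_simps)
  also have "\<dots> = (\<Sum>i\<in>UNIV. \<Sum>j\<in>UNIV. (s $ i * t $ j) * (\<integral>\<omega>. X \<omega> $ i * Y \<omega> $ j \<partial>P))"
    using int by simp
  also have "\<dots> = s \<bullet> (xcov P X Y *v t)"
    by (simp add: inner_vec_def matrix_vector_mult_def xcov_def sum_distrib_left ac_simps)
  finally show ?thesis ..
qed

lemma xcov_add_left:
  assumes "vec_over G X" "vec_over G X'" "vec_over G Y"
  shows "xcov P (\<lambda>\<omega>. X \<omega> + X' \<omega>) Y = xcov P X Y + xcov P X' Y"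
proof (rule matrix_eq_bilinear)
  fix s t
  show "s \<bullet> (xcov P (\<lambda>\<omega>. X \<omega> + X' \<omega>) Y *v t) = s \<bullet> ((xcov P X Y + xcov P X' Y) *v t)"
    using vec_over_integrable_products[OF assms(1,3)] vec_over_integrable_products[OF assms(2,3)]
    by (simp add: xcov_bilinear vec_over_add assms matrix_vector_mult_add_rdistrib inner_add_right distrib_right)
qed

lemma xcov_matrix_left:
  assumes "vec_over G X" "vec_over G Y"
  shows "xcov P (\<lambda>\<omega>. K *v X \<omega>) Y = K ** xcov P X Y"
proof (rule matrix_eq_bilinear)
  fix s t
  have "s \<bullet> ((K ** xcov P X Y) *v t) = (transpose K *v s) \<bullet> (xcov P X Y *v t)"
    by (simp only: inner_matrix_vector flip: matrix_vector_mul_assoc)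
  also have "\<dots> = s \<bullet> (xcov P (\<lambda>\<omega>. K *v X \<omega>) Y *v t)"
    unfolding xcov_bilinear[OF assms] xcov_bilinear[OF vec_over_matrix[OF assms(1)] assms(2)]
      inner_matrix_vector[of s K] ..
  finally show "s \<bullet> (xcov P (\<lambda>\<omega>. K *v X \<omega>) Y *v t) = s \<bullet> ((K ** xcov P X Y) *v t)" ..
qed

lemma xcov_zero_left: "xcov P (\<lambda>_. 0) Y = 0"
  by (simp add: xcov_def zero_vec_def)

lemma xcov_sum_left:
  assumes "\<And>i. i \<in> I \<Longrightarrow> vec_over G (X i)" "vec_over G Y"
  shows "xcov P (\<lambda>\<omega>. \<Sum>i\<in>I. X i \<omega>) Y = (\<Sum>i\<in>I. xcov P (X i) Y)"
  using assms
  by (induction I rule: infinite_finite_induct)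
    (simp_all add: xcov_zero_left xcov_add_left vec_over_sum)

lemma xcov_add_right:
  assumes "vec_over G X" "vec_over G Y" "vec_over G Y'"
  shows "xcov P X (\<lambda>\<omega>. Y \<omega> + Y' \<omega>) = xcov P X Y + xcov P X Y'"
proof -
  have "transpose (xcov P (\<lambda>\<omega>. Y \<omega> + Y' \<omega>) X) = transpose (xcov P Y X + xcov P Y' X)"
    using assms by (simp add: xcov_add_left)
  also have "\<dots> = transpose (xcov P Y X) + transpose (xcov P Y' X)"
    by (simp add: transpose_def vec_eq_iff)
  finally show ?thesis by (simp only: transpose_xcov)
qed

lemma xcov_matrix_right:
  assumes "vec_over G X" "vec_over G Y"
  shows "xcov P X (\<lambda>\<omega>. K *v Y \<omega>) = xcov P X Y ** transpose K"
  using arg_cong[OF xcov_matrix_left[OF assms(2,1), of K], of transpose]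
  by (simp only: transpose_xcov matrix_transpose_mul)

lemma psd_xcov: "vec_over G X \<Longrightarrow> psd (xcov P X X)"
  by (simp add: psd_def transpose_xcov xcov_bilinear flip: power2_eq_square)

lemma covariance_eq_xcov:
  assumes "vec_over G X"
  shows "covariance P (\<lambda>\<omega>. m + X \<omega>) = xcov P X X"
  using vec_over_mean[OF assms, of m] by (simp add: covariance_def xcov_def)

text \<open>
The cross term has mean zero, so only the mean and the covariance of the input enter its cost.
\<close>

lemma expected_quadratic_cost:
  fixes X :: "'a \<Rightarrow> real^'k"
  assumes X: "vec_over G X"
  shows "integrable P (\<lambda>\<omega>. (v + X \<omega>) \<bullet> (R *v (v + X \<omega>)))"
    and "(\<integral>\<omega>. (v + X \<omega>) \<bullet> (R *v (v + X \<omega>)) \<partial>P)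
      = v \<bullet> (R *v v) + (\<Sum>i\<in>UNIV. \<Sum>j\<in>UNIV. R $ i $ j * xcov P X X $ i $ j)"
proof -
  have eq: "(v + X \<omega>) \<bullet> (R *v (v + X \<omega>)) = v \<bullet> (R *v v) + ((transpose R *v v + R *v v) \<bullet> X \<omega>)
      + (\<Sum>i\<in>UNIV. \<Sum>j\<in>UNIV. R $ i $ j * (X \<omega> $ i * X \<omega> $ j))" for \<omega>
  proof -
    have "X \<omega> \<bullet> (R *v X \<omega>) = (\<Sum>i\<in>UNIV. \<Sum>j\<in>UNIV. R $ i $ j * (X \<omega> $ i * X \<omega> $ j))"
      by (simp add: inner_vec_def matrix_vector_mult_def sum_distrib_left ac_simps)
    moreover have "v \<bullet> (R *v X \<omega>) = (transpose R *v v) \<bullet> X \<omega>"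
      by (rule inner_matrix_vector)
    ultimately show ?thesis
      unfolding matrix_vector_right_distrib inner_add_left inner_add_right
      by (simp only: inner_commute[of "X \<omega>" "R *v v"] ac_simps)
  qed
  have int: "integrable P (\<lambda>\<omega>. X \<omega> $ i * X \<omega> $ j)" for i j
    using vec_over_integrable_products[OF X X, of "axis i 1" "axis j 1"] by (simp add: inner_axis')
  show "integrable P (\<lambda>\<omega>. (v + X \<omega>) \<bullet> (R *v (v + X \<omega>)))"
    unfolding eq
    by (intro Bochner_Integration.integrable_add Bochner_Integration.integrable_sum integrable_mult_right
        vec_over_inner(3)[OF X] int integrable_const)
  have "(\<integral>\<omega>. (v + X \<omega>) \<bullet> (R *v (v + X \<omega>)) \<partial>P)
    = v \<bullet> (R *v v) + 0 + (\<Sum>i\<in>UNIV. \<Sum>j\<in>UNIV. R $ i $ j * (\<integral>\<omega>. X \<omega> $ i * X \<omega> $ j \<partial>P))"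
    unfolding eq using int vec_over_inner(3,4)[OF X, of "transpose R *v v + R *v v"]
    by (simp add: prob_space del: integral_inner_right integrable_inner_right)
  then show "(\<integral>\<omega>. (v + X \<omega>) \<bullet> (R *v (v + X \<omega>)) \<partial>P)
      = v \<bullet> (R *v v) + (\<Sum>i\<in>UNIV. \<Sum>j\<in>UNIV. R $ i $ j * xcov P X X $ i $ j)"
    by (simp add: xcov_def)
qed

lemma char_vec_over:
  assumes X: "vec_over G X"
  shows "(\<integral>x. iexp (t \<bullet> x) \<partial>distr P borel (\<lambda>\<omega>. m + X \<omega>))
    = iexp (t \<bullet> m) * complex_of_real (exp (- (t \<bullet> (xcov P X X *v t)) / 2))"
proof -
  note [measurable] = vec_over_measurable[OF X]
  have "(\<integral>x. iexp (t \<bullet> x) \<partial>distr P borel (\<lambda>\<omega>. m + X \<omega>)) = (\<integral>\<omega>. iexp (t \<bullet> m) * iexp (t \<bullet> X \<omega>) \<partial>P)"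
    by (subst integral_distr) (auto simp: inner_add_right exp_add distrib_left)
  also have "\<dots> = iexp (t \<bullet> m) * (\<integral>\<omega>. iexp (t \<bullet> X \<omega>) \<partial>P)" by simp
  finally show ?thesis
    by (simp only: vec_over_inner(5)[OF X] xcov_bilinear[OF X X] power2_eq_square)
qed

end

text \<open>
Jointly Gaussian vectors, possibly on different probability spaces and with singular covariance, have the
same law as soon as mean and covariance agree.
\<close>

lemma distr_eq_of_xcov_eq:
  assumes "gaussian_space P G" "gaussian_space P' G'" and X: "vec_over G X" and X': "vec_over G' X'"
    and "xcov P X X = xcov P' X' X'"
  shows "distr P borel (\<lambda>\<omega>. m + X \<omega>) = distr P' borel (\<lambda>\<omega>. m + X' \<omega>)"
proof -
  interpret P: gaussian_space P G by fact
  interpret P': gaussian_space P' G' by fact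
  note [measurable] = P.vec_over_measurable[OF X] P'.vec_over_measurable[OF X']
  show ?thesis
  proof (rule measure_eqI_char)
    show "prob_space (distr P borel (\<lambda>\<omega>. m + X \<omega>))" by (rule P.prob_space_distr) measurable
    show "prob_space (distr P' borel (\<lambda>\<omega>. m + X' \<omega>))" by (rule P'.prob_space_distr) measurable
    fix t
    show "(\<integral>x. iexp (t \<bullet> x) \<partial>distr P borel (\<lambda>\<omega>. m + X \<omega>)) = (\<integral>x. iexp (t \<bullet> x) \<partial>distr P' borel (\<lambda>\<omega>. m + X' \<omega>))"
      by (simp only: P.char_vec_over[OF X] P'.char_vec_over[OF X'] assms(5))
  qed simp_all
qed

lemma sets_gaussian [measurable_cong, simp]: "sets (gaussian m S) = sets borel"
  by (simp add: gaussian_def)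

lemma measurable_matrix_vector [measurable]:
  "(\<lambda>z::real^'l. (K::real^'l^'k) *v z) \<in> borel_measurable borel"
  by (intro borel_measurable_continuous_onI matrix_vector_mult_linear_continuous_on)

lemma prob_space_gaussian: "prob_space (gaussian m S :: (real^'n) measure)"
  unfolding gaussian_def by (intro prob_space.prob_space_distr prob_space_std_gaussian) measurable

text \<open>
A linear form in $T z$ is the linear form with coefficients $T^T a$ in the standard normal vector $z$. The
variance uses $T T = S$ and the symmetry of $T$, hence that $S$ has a square root.
\<close>

lemma gaussian_linear_form:
  fixes S :: "real^'n^'n"
  shows "centred_gaussian (gaussian 0 S) (\<lambda>x. a \<bullet> x)"
    and "psd S \<Longrightarrow> (\<integral>x. (a \<bullet> x)\<^sup>2 \<partial>gaussian 0 S) = a \<bullet> (S *v a)"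
proof -
  let ?T = "psd_sqrt S"
  let ?b = "transpose ?T *v a"
  have ab: "a \<bullet> (?T *v z) = ?b \<bullet> z" for z by (rule inner_matrix_vector)
  show "centred_gaussian (gaussian 0 S) (\<lambda>x. a \<bullet> x)"
    using std_gaussian_linear_form(1)[of ?b]
    by (simp add: centred_gaussian_def gaussian_def integral_distr integrable_distr_eq char_distr ab
        distr_distr o_def del: transpose_matrix_vector)
  assume S: "psd S"
  have "(\<integral>x. (a \<bullet> x)\<^sup>2 \<partial>gaussian 0 S) = ?b \<bullet> ?b"
    by (simp add: gaussian_def integral_distr ab std_gaussian_linear_form(2) del: transpose_matrix_vector)
  also have "\<dots> = a \<bullet> ((?T ** transpose ?T) *v a)"
    by (simp only: inner_matrix_vector[of a] flip: matrix_vector_mul_assoc)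
  finally show "(\<integral>x. (a \<bullet> x)\<^sup>2 \<partial>gaussian 0 S) = a \<bullet> (S *v a)"
    using psd_sqrt_works[OF S] by simp
qed

lemma (in prob_space) xcov_indep_zero:
  assumes ind: "\<And>i j. indep_var borel (\<lambda>\<omega>. X \<omega> $ i) borel (\<lambda>\<omega>. Y \<omega> $ j)"
    and X: "\<And>t. centred_gaussian M (\<lambda>\<omega>. t \<bullet> X \<omega>)" and Y: "\<And>t. centred_gaussian M (\<lambda>\<omega>. t \<bullet> Y \<omega>)"
  shows "xcov M X Y = 0"
proof -
  have "(\<integral>\<omega>. X \<omega> $ i * Y \<omega> $ j \<partial>M) = 0" for i j
  proof -
    have X': "centred_gaussian M (\<lambda>\<omega>. X \<omega> $ i)" and Y': "centred_gaussian M (\<lambda>\<omega>. Y \<omega> $ j)"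
      using X[of "axis i 1"] Y[of "axis j 1"] by (simp_all add: inner_axis')
    have "(\<integral>\<omega>. X \<omega> $ i * Y \<omega> $ j \<partial>M) = (\<integral>\<omega>. X \<omega> $ i \<partial>M) * (\<integral>\<omega>. Y \<omega> $ j \<partial>M)"
      using centred_gaussianD(1,2)[OF X'] centred_gaussianD(1,2)[OF Y'] ind
      by (simp add: indep_var_lebesgue_integral integrable_of_square)
    then show ?thesis using centred_gaussianD(3)[OF X'] by simp
  qed
  then show ?thesis by (simp add: xcov_def vec_eq_iff)
qed

definition linear_span_of :: "'i set \<Rightarrow> ('i \<Rightarrow> 'a \<Rightarrow> real^'k) \<Rightarrow> ('a \<Rightarrow> real) set" where
  "linear_span_of I \<xi> = {\<lambda>\<omega>. \<Sum>i\<in>I. a i \<bullet> \<xi> i \<omega> | a. True}"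

lemma vec_over_linear_span_of:
  assumes "finite I" "i \<in> I" shows "vec_over (linear_span_of I \<xi>) (\<xi> i)"
  unfolding vec_over_def
proof
  fix t
  have "(\<Sum>j\<in>I. (if j = i then t else 0) \<bullet> \<xi> j \<omega>) = t \<bullet> \<xi> i \<omega>" for \<omega>
    using assms by (simp add: if_distrib[of "\<lambda>x. x \<bullet> _"] cong: if_cong)
  then show "(\<lambda>\<omega>. t \<bullet> \<xi> i \<omega>) \<in> linear_span_of I \<xi>"
    unfolding linear_span_of_def by (auto intro!: exI[of _ "\<lambda>j. if j = i then t else 0"])
qed

lemma (in prob_space) gaussian_space_indep:
  fixes \<xi> :: "'i \<Rightarrow> 'a \<Rightarrow> real^'k"
  assumes "finite I" and ind: "indep_vars (\<lambda>_. borel) \<xi> I"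
    and \<xi>: "\<And>i t. i \<in> I \<Longrightarrow> centred_gaussian M (\<lambda>\<omega>. t \<bullet> \<xi> i \<omega>)"
  shows "gaussian_space M (linear_span_of I \<xi>)"
proof
  fix f g :: "'a \<Rightarrow> real" and c :: real
  assume "f \<in> linear_span_of I \<xi>"
  then obtain a where f: "f = (\<lambda>\<omega>. \<Sum>i\<in>I. a i \<bullet> \<xi> i \<omega>)" by (auto simp: linear_span_of_def)
  have "indep_vars (\<lambda>_. borel) (\<lambda>i \<omega>. a i \<bullet> \<xi> i \<omega>) I"
    by (rule indep_vars_compose2[OF ind, of "\<lambda>i x. a i \<bullet> x"]) auto
  from centred_gaussian_sum_indep[OF \<open>finite I\<close> this] \<xi>
  show "centred_gaussian M f" unfolding f by blast
  have "(\<lambda>\<omega>. c * f \<omega>) = (\<lambda>\<omega>. \<Sum>i\<in>I. (c *\<^sub>R a i) \<bullet> \<xi> i \<omega>)"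
    unfolding f by (simp add: sum_distrib_left)
  then show "(\<lambda>\<omega>. c * f \<omega>) \<in> linear_span_of I \<xi>"
    unfolding linear_span_of_def by (intro CollectI exI[of _ "\<lambda>i. c *\<^sub>R a i"] conjI TrueI)
  assume "g \<in> linear_span_of I \<xi>"
  then obtain b where g: "g = (\<lambda>\<omega>. \<Sum>i\<in>I. b i \<bullet> \<xi> i \<omega>)" by (auto simp: linear_span_of_def)
  have "(\<lambda>\<omega>. f \<omega> + g \<omega>) = (\<lambda>\<omega>. \<Sum>i\<in>I. (a i + b i) \<bullet> \<xi> i \<omega>)"
    unfolding f g by (simp add: inner_add_left sum.distrib)
  then show "(\<lambda>\<omega>. f \<omega> + g \<omega>) \<in> linear_span_of I \<xi>" by (auto simp: linear_span_of_def)
next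
  have "(\<lambda>_. 0) = (\<lambda>\<omega>. \<Sum>i\<in>I. 0 \<bullet> \<xi> i \<omega>)" by simp
  then show "(\<lambda>_. 0) \<in> linear_span_of I \<xi>"
    unfolding linear_span_of_def by (intro CollectI exI[of _ "\<lambda>_. 0"]) simp
qed

lemma distr_pair_snd:
  assumes "prob_space P" "prob_space Q" shows "distr (P \<Otimes>\<^sub>M Q) Q snd = Q"
proof (rule measure_eqI)
  interpret P: prob_space P by fact
  interpret Q: prob_space Q by fact
  fix A assume "A \<in> sets (distr (P \<Otimes>\<^sub>M Q) Q snd)"
  then have A: "A \<in> sets Q" by simp
  have "snd -` A \<inter> space (P \<Otimes>\<^sub>M Q) = space P \<times> A"
    using sets.sets_into_space[OF A] by (auto simp: space_pair_measure)
  then show "emeasure (distr (P \<Otimes>\<^sub>M Q) Q snd) A = emeasure Q A"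
    using A by (simp add: emeasure_distr Q.emeasure_pair_measure_Times P.emeasure_space_1)
qed simp

definition direct_sum :: "('a \<Rightarrow> real) set \<Rightarrow> ('b \<Rightarrow> real) set \<Rightarrow> ('a \<times> 'b \<Rightarrow> real) set" where
  "direct_sum G H = {\<lambda>\<omega>. f (fst \<omega>) + h (snd \<omega>) | f h. f \<in> G \<and> h \<in> H}"

text \<open>
A function of the first coordinate and a function of the second are independent under the product
measure, so sums of centred Gaussian variables from the two factors are again centred Gaussian.
\<close>

lemma gaussian_space_product:
  assumes "gaussian_space P G" "gaussian_space Q H"
  shows "gaussian_space (P \<Otimes>\<^sub>M Q) (direct_sum G H)" (is ?space)
    and "\<And>X. vec_over G X \<Longrightarrow> vec_over (direct_sum G H) (\<lambda>\<omega>. X (fst \<omega>))"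
    and "\<And>Y. vec_over H Y \<Longrightarrow> vec_over (direct_sum G H) (\<lambda>\<omega>. Y (snd \<omega>))"
    and "\<And>X X'. vec_over G X \<Longrightarrow> vec_over G X' \<Longrightarrow>
      xcov (P \<Otimes>\<^sub>M Q) (\<lambda>\<omega>. X (fst \<omega>)) (\<lambda>\<omega>. X' (fst \<omega>)) = xcov P X X'"
    and "\<And>Y Y'. vec_over H Y \<Longrightarrow> vec_over H Y' \<Longrightarrow>
      xcov (P \<Otimes>\<^sub>M Q) (\<lambda>\<omega>. Y (snd \<omega>)) (\<lambda>\<omega>. Y' (snd \<omega>)) = xcov Q Y Y'"
    and "\<And>X Y. vec_over G X \<Longrightarrow> vec_over H Y \<Longrightarrow>
      xcov (P \<Otimes>\<^sub>M Q) (\<lambda>\<omega>. X (fst \<omega>)) (\<lambda>\<omega>. Y (snd \<omega>)) = 0"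
proof -
  interpret G: gaussian_space P G by fact
  interpret H: gaussian_space Q H by fact
  interpret PQ: pair_prob_space P Q ..
  have fst: "distr (P \<Otimes>\<^sub>M Q) P fst = P" by (rule H.distr_pair_fst)
  have snd: "distr (P \<Otimes>\<^sub>M Q) Q snd = Q"
    by (rule distr_pair_snd) unfold_locales
  have ind: "PQ.indep_var borel (\<lambda>\<omega>. f (fst \<omega>)) borel (\<lambda>\<omega>. h (snd \<omega>))"
    if [measurable]: "f \<in> borel_measurable P" "h \<in> borel_measurable Q" for f h :: "_ \<Rightarrow> real"
  proof -
    interpret h: prob_space "distr Q borel h" by (rule H.prob_space_distr) measurable
    have "distr (P \<Otimes>\<^sub>M Q) borel (\<lambda>\<omega>. f (fst \<omega>)) = distr (distr (P \<Otimes>\<^sub>M Q) P fst) borel f"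
      "distr (P \<Otimes>\<^sub>M Q) borel (\<lambda>\<omega>. h (snd \<omega>)) = distr (distr (P \<Otimes>\<^sub>M Q) Q snd) borel h"
      by (simp_all add: distr_distr o_def)
    moreover have "distr P borel f \<Otimes>\<^sub>M distr Q borel h
        = distr (P \<Otimes>\<^sub>M Q) (borel \<Otimes>\<^sub>M borel) (\<lambda>(x, y). (f x, h y))"
      by (rule pair_measure_distr) (unfold_locales, measurable)
    ultimately show ?thesis
      unfolding PQ.indep_var_distribution_eq fst snd by (simp add: case_prod_beta')
  qed
  have cg1: "centred_gaussian (P \<Otimes>\<^sub>M Q) (\<lambda>\<omega>. f (fst \<omega>))" if "f \<in> G" for f
    by (rule centred_gaussian_distr[of _ _ P]) (simp_all add: fst G.centred that)
  have cg2: "centred_gaussian (P \<Otimes>\<^sub>M Q) (\<lambda>\<omega>. h (snd \<omega>))" if "h \<in> H" for h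
    by (rule centred_gaussian_distr[of _ _ Q]) (simp_all add: snd H.centred that)
  show ?space
  proof
    show "(\<lambda>_. 0) \<in> direct_sum G H"
      unfolding direct_sum_def using G.zero H.zero by force
    fix f g and c :: real assume "f \<in> direct_sum G H"
    then obtain f1 f2 where f: "f = (\<lambda>\<omega>. f1 (fst \<omega>) + f2 (snd \<omega>))" "f1 \<in> G" "f2 \<in> H"
      by (auto simp: direct_sum_def)
    have "PQ.indep_var borel (\<lambda>\<omega>. f1 (fst \<omega>)) borel (\<lambda>\<omega>. f2 (snd \<omega>))"
      by (intro ind centred_gaussianD(1) G.centred H.centred f)
    then show "centred_gaussian (P \<Otimes>\<^sub>M Q) f"
      unfolding f(1) by (intro PQ.centred_gaussian_add_indep cg1 cg2 f)
    show "(\<lambda>\<omega>. c * f \<omega>) \<in> direct_sum G H"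
      unfolding direct_sum_def f(1)
      using G.scale[OF f(2), of c] H.scale[OF f(3), of c] by (force simp: distrib_left)
    assume "g \<in> direct_sum G H"
    then obtain g1 g2 where g: "g = (\<lambda>\<omega>. g1 (fst \<omega>) + g2 (snd \<omega>))" "g1 \<in> G" "g2 \<in> H"
      by (auto simp: direct_sum_def)
    have "(\<lambda>\<omega>. f \<omega> + g \<omega>) = (\<lambda>\<omega>. (f1 (fst \<omega>) + g1 (fst \<omega>)) + (f2 (snd \<omega>) + g2 (snd \<omega>)))"
      by (simp add: f(1) g(1) ac_simps)
    then show "(\<lambda>\<omega>. f \<omega> + g \<omega>) \<in> direct_sum G H"
      unfolding direct_sum_def using G.add[OF f(2) g(2)] H.add[OF f(3) g(3)] by force
  qed
  show lift1: "vec_over (direct_sum G H) (\<lambda>\<omega>. X (fst \<omega>))" if "vec_over G X" for X :: "'a \<Rightarrow> real^'k"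
    using that H.zero unfolding vec_over_def direct_sum_def by force
  show lift2: "vec_over (direct_sum G H) (\<lambda>\<omega>. Y (snd \<omega>))" if "vec_over H Y" for Y :: "'b \<Rightarrow> real^'k"
    using that G.zero unfolding vec_over_def direct_sum_def by force
  show "xcov (P \<Otimes>\<^sub>M Q) (\<lambda>\<omega>. X (fst \<omega>)) (\<lambda>\<omega>. X' (fst \<omega>)) = xcov P X X'"
    if "vec_over G X" "vec_over G X'" for X :: "'a \<Rightarrow> real^'k" and X' :: "'a \<Rightarrow> real^'l"
  proof -
    note [measurable] = G.vec_over_component_measurable[OF that(1)] G.vec_over_component_measurable[OF that(2)]
    have "(\<integral>\<omega>. X \<omega> $ i * X' \<omega> $ j \<partial>distr (P \<Otimes>\<^sub>M Q) P fst)
        = (\<integral>\<omega>. X (fst \<omega>) $ i * X' (fst \<omega>) $ j \<partial>(P \<Otimes>\<^sub>M Q))" for i j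
      by (rule integral_distr) measurable
    then show ?thesis by (simp add: xcov_def fst)
  qed
  show "xcov (P \<Otimes>\<^sub>M Q) (\<lambda>\<omega>. Y (snd \<omega>)) (\<lambda>\<omega>. Y' (snd \<omega>)) = xcov Q Y Y'"
    if "vec_over H Y" "vec_over H Y'" for Y :: "'b \<Rightarrow> real^'k" and Y' :: "'b \<Rightarrow> real^'l"
  proof -
    note [measurable] = H.vec_over_component_measurable[OF that(1)] H.vec_over_component_measurable[OF that(2)]
    have "(\<integral>\<omega>. Y \<omega> $ i * Y' \<omega> $ j \<partial>distr (P \<Otimes>\<^sub>M Q) Q snd)
        = (\<integral>\<omega>. Y (snd \<omega>) $ i * Y' (snd \<omega>) $ j \<partial>(P \<Otimes>\<^sub>M Q))" for i j
      by (rule integral_distr) measurable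
    then show ?thesis by (simp add: xcov_def snd)
  qed
  show "xcov (P \<Otimes>\<^sub>M Q) (\<lambda>\<omega>. X (fst \<omega>)) (\<lambda>\<omega>. Y (snd \<omega>)) = 0"
    if "vec_over G X" "vec_over H Y" for X :: "'a \<Rightarrow> real^'k" and Y :: "'b \<Rightarrow> real^'l"
  proof (rule PQ.xcov_indep_zero)
    show "PQ.indep_var borel (\<lambda>\<omega>. X (fst \<omega>) $ i) borel (\<lambda>\<omega>. Y (snd \<omega>) $ j)" for i j
      by (rule ind) (rule G.vec_over_component_measurable[OF that(1)],
          rule H.vec_over_component_measurable[OF that(2)])
  qed (use that cg1 cg2 in \<open>auto simp: vec_over_def\<close>)
qed

section \<open>Second-order statistics of the two closed loops\<close>

lemma pd_inverse:
  fixes S :: "real^'k^'k"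
  assumes "pd S"
  shows "matrix_inv S ** S = mat 1"
proof -
  have "x = 0" if "S *v x = 0" for x
    using assms that unfolding pd_def by (metis inner_zero_right less_irrefl)
  then have "invertible S"
    using matrix_left_invertible_ker[of S] invertible_left_inverse[of S] by blast
  then show ?thesis
    unfolding invertible_def matrix_inv_def by (rule someI2_ex) simp
qed

text \<open>
By polarization, $s \bullet M t$ is determined by the quadratic form at $s$, $t$ and $s + t$.
\<close>

lemma symmetric_matrix_eq_quadratic:
  fixes M M' :: "real^'k^'k"
  assumes "transpose M = M" "transpose M' = M'" and eq: "\<And>t. t \<bullet> (M *v t) = t \<bullet> (M' *v t)"
  shows "M = M'"
proof (rule matrix_eq_bilinear)
  fix s t
  have polar: "2 * (s \<bullet> (L *v t)) = (s + t) \<bullet> (L *v (s + t)) - s \<bullet> (L *v s) - t \<bullet> (L *v t)"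
    if "transpose L = L" for L :: "real^'k^'k"
  proof -
    have "t \<bullet> (L *v s) = s \<bullet> (L *v t)"
      using inner_matrix_vector[of t L s] that by (simp add: inner_commute)
    then show ?thesis
      by (simp add: matrix_vector_right_distrib inner_add_left inner_add_right)
  qed
  show "s \<bullet> (M *v t) = s \<bullet> (M' *v t)"
    using polar[OF assms(1)] polar[OF assms(2)] by (simp add: eq)
qed

lemma xcov_zero_commute: "xcov P X Y = 0 \<Longrightarrow> xcov P Y X = 0"
  by (simp add: xcov_def vec_eq_iff mult.commute)

context gaussian_space
begin

text \<open>
The covariance of the next state involves only the covariance of the state, the cross-covariance of input
and state, and the covariances of the input and the disturbance. Two closed loops in which these agree at
one time therefore have equal state covariances at the next.
\<close>

lemma xcov_linear_update:
  fixes F :: "real^'k^'k" and B :: "real^'l^'k"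
  assumes X: "vec_over G X" and U: "vec_over G U" and W: "vec_over G W"
    and XW: "xcov P X W = 0" and UW: "xcov P U W = 0"
  defines "Y \<equiv> \<lambda>\<omega>. F *v X \<omega> + B *v U \<omega> + W \<omega>"
  shows "xcov P Y Y = F ** xcov P X X ** transpose F + F ** transpose (xcov P U X) ** transpose B
    + (B ** xcov P U X ** transpose F + B ** xcov P U U ** transpose B) + xcov P W W"
proof -
  have WX: "xcov P W X = 0" and WU: "xcov P W U = 0"
    using XW UW by (auto intro: xcov_zero_commute)
  have FX: "vec_over G (\<lambda>\<omega>. F *v X \<omega>)" and BU: "vec_over G (\<lambda>\<omega>. B *v U \<omega>)"
    using X U by (auto intro: vec_over_matrix)
  note vo = X U W FX BU vec_over_add[OF FX BU]
  show ?thesis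
    unfolding Y_def
    by (simp add: vo xcov_add_left xcov_add_right vec_over_add xcov_matrix_left xcov_matrix_right
        XW UW WX WU transpose_xcov matrix_mul_assoc matrix_add_ldistrib)
qed

text \<open>
The decomposition of an input into linear state feedback and a part uncorrelated with the state. Both
right-hand sides mention $V$ only through its covariance, which is why the residual of a history policy may
be exchanged for fresh noise.
\<close>

lemma xcov_pythagoras:
  assumes X: "vec_over G X" and V: "vec_over G V" and VX: "xcov P V X = 0"
  shows "xcov P (\<lambda>\<omega>. K *v X \<omega> + V \<omega>) X = K ** xcov P X X"
    and "xcov P (\<lambda>\<omega>. K *v X \<omega> + V \<omega>) (\<lambda>\<omega>. K *v X \<omega> + V \<omega>)
      = K ** xcov P X X ** transpose K + xcov P V V"
proof -
  have XV: "xcov P X V = 0"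
    using VX by (rule xcov_zero_commute)
  have KX: "vec_over G (\<lambda>\<omega>. K *v X \<omega>)" using X by (rule vec_over_matrix)
  note vo = X V KX
  show "xcov P (\<lambda>\<omega>. K *v X \<omega> + V \<omega>) X = K ** xcov P X X"
    by (simp add: vo xcov_add_left xcov_matrix_left VX)
  show "xcov P (\<lambda>\<omega>. K *v X \<omega> + V \<omega>) (\<lambda>\<omega>. K *v X \<omega> + V \<omega>)
      = K ** xcov P X X ** transpose K + xcov P V V"
    by (simp add: vo xcov_add_left xcov_add_right vec_over_add xcov_matrix_left xcov_matrix_right
        VX XV matrix_mul_assoc)
qed

text \<open>
The normal equations of linear regression: $E[U X^T] - K E[X X^T] = 0$.
\<close>

lemma regression_residual_orthogonal:
  assumes X: "vec_over G X" and U: "vec_over G U" and "pd (xcov P X X)"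
  defines "K \<equiv> xcov P U X ** matrix_inv (xcov P X X)"
  shows "xcov P (\<lambda>\<omega>. U \<omega> - K *v X \<omega>) X = 0"
proof -
  define V where "V \<omega> = U \<omega> - K *v X \<omega>" for \<omega>
  have KX: "vec_over G (\<lambda>\<omega>. K *v X \<omega>)" using X by (rule vec_over_matrix)
  have V: "vec_over G V"
    unfolding V_def using U KX by (rule vec_over_diff)
  have "xcov P (\<lambda>\<omega>. V \<omega> + K *v X \<omega>) X = xcov P V X + K ** xcov P X X"
    by (simp add: xcov_add_left[OF V KX X] xcov_matrix_left[OF X X])
  moreover have "K ** xcov P X X = xcov P U X"
    unfolding K_def using pd_inverse[OF assms(3)] by (simp flip: matrix_mul_assoc)
  ultimately have "xcov P V X = 0" by (simp add: V_def)
  then show ?thesis by (simp add: V_def[abs_def])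
qed

lemma integral_running_cost:
  assumes "\<And>k. k < N \<Longrightarrow> vec_over G (U k)"
  shows "(\<integral>\<omega>. (\<Sum>k<N. (v k + U k \<omega>) \<bullet> (R k *v (v k + U k \<omega>))) \<partial>P)
    = (\<Sum>k<N. v k \<bullet> (R k *v v k) + (\<Sum>i\<in>UNIV. \<Sum>j\<in>UNIV. R k $ i $ j * xcov P (U k) (U k) $ i $ j))"
proof -
  have "(\<integral>\<omega>. (\<Sum>k<N. (v k + U k \<omega>) \<bullet> (R k *v (v k + U k \<omega>))) \<partial>P)
      = (\<Sum>k<N. \<integral>\<omega>. (v k + U k \<omega>) \<bullet> (R k *v (v k + U k \<omega>)) \<partial>P)"
    by (rule Bochner_Integration.integral_sum) (simp add: expected_quadratic_cost(1) assms)
  also have "\<dots> = (\<Sum>k<N. v k \<bullet> (R k *v v k)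
      + (\<Sum>i\<in>UNIV. \<Sum>j\<in>UNIV. R k $ i $ j * xcov P (U k) (U k) $ i $ j))"
    by (rule sum.cong) (simp_all add: expected_quadratic_cost(2) assms)
  finally show ?thesis .
qed

end

text \<open>
The mean of the state in either closed loop: feedback acts on deviations from the mean only, so the mean
is driven by the open-loop inputs $v_k$ alone.
\<close>

fun mean_state ::
  "(nat \<Rightarrow> real^'n^'n) \<Rightarrow> (nat \<Rightarrow> real^'m^'n) \<Rightarrow> real^'n \<Rightarrow> (nat \<Rightarrow> real^'m) \<Rightarrow> nat \<Rightarrow> real^'n" where
  "mean_state A B m v 0 = m"
| "mean_state A B m v (Suc k) = A k *v mean_state A B m v k + B k *v v k"

text \<open>
The second-order structure of the data. Within the Gaussian space $G$ independence amounts to zero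
cross-covariance, which, unlike independence, passes to linear combinations term by term.
\<close>

locale disturbed_system = gaussian_space P G for P :: "'a measure" and G +
  fixes N :: nat and A :: "nat \<Rightarrow> real^'n^'n" and B :: "nat \<Rightarrow> real^'m^'n"
    and x0 :: "'a \<Rightarrow> real^'n" and w :: "nat \<Rightarrow> 'a \<Rightarrow> real^'n" and mu0 :: "real^'n"
  assumes init: "vec_over G (\<lambda>\<omega>. x0 \<omega> - mu0)"
    and noise: "k < N \<Longrightarrow> vec_over G (w k)"
    and init_noise: "k < N \<Longrightarrow> xcov P (\<lambda>\<omega>. x0 \<omega> - mu0) (w k) = 0"
    and noise_noise: "j < N \<Longrightarrow> k < N \<Longrightarrow> j \<noteq> k \<Longrightarrow> xcov P (w j) (w k) = 0"
begin

definition hist_dev where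
  "hist_dev \<pi> k \<omega> = hist_state P A B x0 w \<pi> k \<omega> - mean_state A B mu0 (fst \<pi>) k"

definition hist_input_dev where
  "hist_input_dev \<pi> k \<omega> = (\<Sum>\<tau>\<le>k. snd \<pi> k \<tau> *v hist_dev \<pi> \<tau> \<omega>)"

lemma hist_state_split: "hist_state P A B x0 w \<pi> k = (\<lambda>\<omega>. mean_state A B mu0 (fst \<pi>) k + hist_dev \<pi> k \<omega>)"
  by (simp add: hist_dev_def fun_eq_iff)

text \<open>
The means subtracted by the policy are those of the closed-loop states themselves. They are the
deterministic means once the deviations of the past states are known to be centred.
\<close>

lemma hist_input_split:
  assumes "\<And>\<tau>. \<tau> \<le> k \<Longrightarrow> vec_over G (hist_dev \<pi> \<tau>)"
  shows "hist_input P A B x0 w \<pi> k = (\<lambda>\<omega>. fst \<pi> k + hist_input_dev \<pi> k \<omega>)"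
proof -
  have "integral\<^sup>L P (hist_state P A B x0 w \<pi> \<tau>) = mean_state A B mu0 (fst \<pi>) \<tau>" if "\<tau> \<le> k" for \<tau>
    unfolding hist_state_split using assms[OF that] by (rule vec_over_mean)
  then show ?thesis
    by (simp add: fun_eq_iff hist_input_dev_def hist_dev_def)
qed

lemma hist_dev_Suc:
  assumes "\<And>\<tau>. \<tau> \<le> k \<Longrightarrow> vec_over G (hist_dev \<pi> \<tau>)"
  shows "hist_dev \<pi> (Suc k) = (\<lambda>\<omega>. A k *v hist_dev \<pi> k \<omega> + B k *v hist_input_dev \<pi> k \<omega> + w k \<omega>)"
proof -
  have input: "hist_input P A B x0 w \<pi> k = (\<lambda>\<omega>. fst \<pi> k + hist_input_dev \<pi> k \<omega>)"
    using assms by (rule hist_input_split)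
  show ?thesis
    unfolding hist_dev_def[of \<pi> "Suc k", abs_def] hist_state.simps(2) input mean_state.simps
    unfolding hist_state_split[of \<pi> k]
    by (simp add: matrix_vector_right_distrib fun_eq_iff)
qed

text \<open>
Causality: the state at time $k$ is a linear combination of the initial state and $w_0, \dots, w_{k-1}$, so it is
uncorrelated with $w_j$ for $j \ge k$. The induction is strong because the input uses the entire history.
\<close>

lemma hist_dev_orthogonal:
  "k \<le> N \<Longrightarrow> vec_over G (hist_dev \<pi> k) \<and> (\<forall>j. k \<le> j \<and> j < N \<longrightarrow> xcov P (hist_dev \<pi> k) (w j) = 0)"
proof (induction k rule: less_induct)
  case (less k)
  show ?case
  proof (cases k)
    case 0
    then show ?thesis using init init_noise by (simp add: hist_dev_def[abs_def])
  next
    case (Suc l)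
    have IH: "vec_over G (hist_dev \<pi> \<tau>)" "\<And>j. \<tau> \<le> j \<Longrightarrow> j < N \<Longrightarrow> xcov P (hist_dev \<pi> \<tau>) (w j) = 0"
      if "\<tau> \<le> l" for \<tau>
      using less.IH[of \<tau>] less.prems Suc that by auto
    have wl: "vec_over G (w l)" using noise less.prems Suc by simp
    have KX: "vec_over G (\<lambda>\<omega>. snd \<pi> l \<tau> *v hist_dev \<pi> \<tau> \<omega>)" if "\<tau> \<le> l" for \<tau>
      using IH(1)[OF that] by (rule vec_over_matrix)
    have U: "vec_over G (hist_input_dev \<pi> l)"
      unfolding hist_input_dev_def[abs_def] by (rule vec_over_sum) (simp add: KX)
    have AX: "vec_over G (\<lambda>\<omega>. A l *v hist_dev \<pi> l \<omega>)" and BU: "vec_over G (\<lambda>\<omega>. B l *v hist_input_dev \<pi> l \<omega>)"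
      using IH(1)[of l] U by (auto intro: vec_over_matrix)
    have "xcov P (hist_dev \<pi> k) (w j) = 0" if j: "k \<le> j" "j < N" for j
    proof -
      note wj = noise[OF j(2)]
      have "xcov P (hist_input_dev \<pi> l) (w j) = 0"
        unfolding hist_input_dev_def[abs_def] using j Suc wj
        by (subst xcov_sum_left) (auto simp: KX xcov_matrix_left IH)
      then show ?thesis
        unfolding Suc using j Suc wj wl U noise_noise[of l j]
        by (simp add: hist_dev_Suc IH xcov_add_left vec_over_add AX BU xcov_matrix_left)
    qed
    moreover have "vec_over G (hist_dev \<pi> k)"
      unfolding Suc by (simp add: hist_dev_Suc IH(1) vec_over_add AX BU wl)
    ultimately show ?thesis by blast
  qed
qed

lemma vec_over_hist_dev: "k \<le> N \<Longrightarrow> vec_over G (hist_dev \<pi> k)"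
  using hist_dev_orthogonal by blast

lemma vec_over_hist_input_dev: "k < N \<Longrightarrow> vec_over G (hist_input_dev \<pi> k)"
  unfolding hist_input_dev_def[abs_def]
  by (intro vec_over_sum vec_over_matrix vec_over_hist_dev) simp

lemma xcov_hist_input_dev_noise:
  assumes k: "k < N" shows "xcov P (hist_input_dev \<pi> k) (w k) = 0"
proof -
  have "xcov P (hist_input_dev \<pi> k) (w k) = (\<Sum>\<tau>\<le>k. xcov P (\<lambda>\<omega>. snd \<pi> k \<tau> *v hist_dev \<pi> \<tau> \<omega>) (w k))"
    unfolding hist_input_dev_def[abs_def] using k
    by (intro xcov_sum_left vec_over_matrix vec_over_hist_dev noise) auto
  also have "\<dots> = 0"
    using k by (intro sum.neutral) (simp add: xcov_matrix_left vec_over_hist_dev noise hist_dev_orthogonal)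
  finally show ?thesis .
qed

end

text \<open>
Unlike the conditions among the disturbances, the one between $w_j$ and $n_k$ includes $j = k$, since both
enter the state at time $k + 1$.
\<close>

locale randomized_system = disturbed_system P G N A B x0 w mu0
  for P :: "'a measure" and G and N :: nat and A :: "nat \<Rightarrow> real^'n^'n" and B :: "nat \<Rightarrow> real^'m^'n"
    and x0 :: "'a \<Rightarrow> real^'n" and w :: "nat \<Rightarrow> 'a \<Rightarrow> real^'n" and mu0 :: "real^'n" +
  fixes nz :: "nat \<Rightarrow> 'a \<Rightarrow> real^'m"
  assumes nz: "k < N \<Longrightarrow> vec_over G (nz k)"
    and init_nz: "k < N \<Longrightarrow> xcov P (\<lambda>\<omega>. x0 \<omega> - mu0) (nz k) = 0"
    and noise_nz: "j < N \<Longrightarrow> k < N \<Longrightarrow> xcov P (w j) (nz k) = 0"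
    and nz_nz: "j < N \<Longrightarrow> k < N \<Longrightarrow> j \<noteq> k \<Longrightarrow> xcov P (nz j) (nz k) = 0"
begin

definition rand_dev where
  "rand_dev v K k \<omega> = rand_state P A B x0 w nz v K k \<omega> - mean_state A B mu0 v k"

definition rand_input_dev where
  "rand_input_dev v K k \<omega> = K k *v rand_dev v K k \<omega> + nz k \<omega>"

lemma rand_state_split: "rand_state P A B x0 w nz v K k = (\<lambda>\<omega>. mean_state A B mu0 v k + rand_dev v K k \<omega>)"
  by (simp add: rand_dev_def fun_eq_iff)

lemma rand_input_split:
  assumes "vec_over G (rand_dev v K k)"
  shows "rand_input P A B x0 w nz v K k = (\<lambda>\<omega>. v k + rand_input_dev v K k \<omega>)"
proof -
  have "integral\<^sup>L P (rand_state P A B x0 w nz v K k) = mean_state A B mu0 v k"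
    unfolding rand_state_split using assms by (rule vec_over_mean)
  then show ?thesis
    by (simp add: fun_eq_iff rand_input_def rand_feedback_def rand_input_dev_def rand_dev_def)
qed

lemma rand_dev_Suc:
  assumes "vec_over G (rand_dev v K k)"
  shows "rand_dev v K (Suc k) = (\<lambda>\<omega>. A k *v rand_dev v K k \<omega> + B k *v rand_input_dev v K k \<omega> + w k \<omega>)"
  unfolding rand_dev_def[of v K "Suc k", abs_def] rand_state.simps(2) rand_input_def[symmetric]
    rand_input_split[OF assms] mean_state.simps
  unfolding rand_state_split[of v K k]
  by (simp add: matrix_vector_right_distrib fun_eq_iff)

text \<open>
As before, now with two families of future noises. The step is the same for both and is stated for an
arbitrary vector $Y$ uncorrelated with everything that enters $x_{k+1}$.
\<close>

lemma rand_dev_orthogonal: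
  "k \<le> N \<Longrightarrow> vec_over G (rand_dev v K k) \<and>
    (\<forall>j. k \<le> j \<and> j < N \<longrightarrow> xcov P (rand_dev v K k) (w j) = 0 \<and> xcov P (rand_dev v K k) (nz j) = 0)"
proof (induction k)
  case 0
  then show ?case using init init_noise init_nz by (simp add: rand_dev_def[abs_def])
next
  case (Suc k)
  then have IH: "vec_over G (rand_dev v K k)"
    "\<And>j. k \<le> j \<Longrightarrow> j < N \<Longrightarrow> xcov P (rand_dev v K k) (w j) = 0"
    "\<And>j. k \<le> j \<Longrightarrow> j < N \<Longrightarrow> xcov P (rand_dev v K k) (nz j) = 0"
    by auto
  have k: "k < N" using Suc.prems by simp
  note vo = IH(1) noise[OF k] nz[OF k]
  have KX: "vec_over G (\<lambda>\<omega>. K k *v rand_dev v K k \<omega>)" using IH(1) by (rule vec_over_matrix)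
  have U: "vec_over G (rand_input_dev v K k)"
    unfolding rand_input_dev_def[abs_def] by (intro vec_over_add KX vo)
  have AX: "vec_over G (\<lambda>\<omega>. A k *v rand_dev v K k \<omega>)" and BU: "vec_over G (\<lambda>\<omega>. B k *v rand_input_dev v K k \<omega>)"
    using IH(1) U by (auto intro: vec_over_matrix)
  have step: "xcov P (rand_dev v K (Suc k)) Y = 0"
    if Y: "vec_over G Y" and "xcov P (rand_dev v K k) Y = 0" "xcov P (nz k) Y = 0" "xcov P (w k) Y = 0"
    for Y :: "'a \<Rightarrow> real^'z"
  proof -
    have "xcov P (rand_input_dev v K k) Y = 0"
      unfolding rand_input_dev_def[abs_def] using that
      by (simp add: xcov_add_left KX vo xcov_matrix_left)
    then show ?thesis
      using that U by (simp add: rand_dev_Suc IH(1) xcov_add_left vec_over_add AX BU vo xcov_matrix_left)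
  qed
  have "vec_over G (rand_dev v K (Suc k))"
    by (simp add: rand_dev_Suc IH(1) vec_over_add AX BU vo)
  moreover have "xcov P (rand_dev v K (Suc k)) (w j) = 0" "xcov P (rand_dev v K (Suc k)) (nz j) = 0"
    if j: "Suc k \<le> j" "j < N" for j
  proof -
    have "xcov P (nz k) (w j) = 0"
      using noise_nz[OF j(2) k] by (rule xcov_zero_commute)
    then show "xcov P (rand_dev v K (Suc k)) (w j) = 0"
      using j k by (intro step noise noise_noise IH) auto
    show "xcov P (rand_dev v K (Suc k)) (nz j) = 0"
      using j k by (intro step nz nz_nz noise_nz IH) auto
  qed
  ultimately show ?case by blast
qed

lemma vec_over_rand_dev: "k \<le> N \<Longrightarrow> vec_over G (rand_dev v K k)"
  using rand_dev_orthogonal by blast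

lemma vec_over_rand_input_dev: "k < N \<Longrightarrow> vec_over G (rand_input_dev v K k)"
  unfolding rand_input_dev_def[abs_def]
  by (intro vec_over_add vec_over_matrix vec_over_rand_dev nz) auto

lemma xcov_rand_input_dev_noise:
  assumes k: "k < N" shows "xcov P (rand_input_dev v K k) (w k) = 0"
proof -
  have "xcov P (nz k) (w k) = 0"
    using noise_nz[OF k k] by (rule xcov_zero_commute)
  moreover have "vec_over G (\<lambda>\<omega>. K k *v rand_dev v K k \<omega>)"
    using k by (intro vec_over_matrix vec_over_rand_dev) simp
  ultimately show ?thesis
    unfolding rand_input_dev_def[abs_def] using k
    by (simp add: xcov_add_left nz noise xcov_matrix_left vec_over_rand_dev rand_dev_orthogonal)
qed

lemma xcov_nz_rand_dev: "k < N \<Longrightarrow> xcov P (nz k) (rand_dev v K k) = 0"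
  using rand_dev_orthogonal[of k v K] by (auto intro: xcov_zero_commute)

end

section \<open>Gaussian spaces of independent sources\<close>

text \<open>
The scalar family that takes coordinate $a$ of $\xi_i$ and coordinate $b$ of every other $\xi_l$ is independent
as well.
\<close>

lemma (in prob_space) indep_var_components:
  fixes \<xi> :: "'i \<Rightarrow> 'a \<Rightarrow> real^'k"
  assumes ind: "indep_vars (\<lambda>_. borel) \<xi> I" and ij: "i \<in> I" "j \<in> I" "i \<noteq> j"
  shows "indep_var borel (\<lambda>\<omega>. \<xi> i \<omega> $ a) borel (\<lambda>\<omega>. \<xi> j \<omega> $ b)"
proof -
  let ?Z = "\<lambda>l \<omega>. \<xi> l \<omega> $ (if l = i then a else b)"
  have "indep_vars (\<lambda>_. borel) ?Z I"
    by (rule indep_vars_compose2[OF ind, of "\<lambda>l x. x $ (if l = i then a else b)"]) auto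
  then have "indep_vars (\<lambda>_. borel) ?Z (insert i {j})"
    by (rule indep_vars_subset) (use ij in auto)
  from indep_vars_sum[OF _ _ this] ij show ?thesis by auto
qed

lemma centred_gaussian_of_law:
  fixes X :: "'a \<Rightarrow> real^'n"
  assumes [measurable]: "X \<in> borel_measurable M" and law: "distr M borel X = gaussian 0 S"
  shows "centred_gaussian M (\<lambda>\<omega>. t \<bullet> X \<omega>)"
  by (rule centred_gaussian_distr[of _ _ borel]) (simp_all add: law gaussian_linear_form(1))

lemma distr_centred:
  fixes X :: "'a \<Rightarrow> real^'n"
  assumes [measurable]: "X \<in> borel_measurable M" and law: "distr M borel X = gaussian m S"
  shows "distr M borel (\<lambda>\<omega>. X \<omega> - m) = gaussian 0 S"
proof -
  have "distr M borel (\<lambda>\<omega>. X \<omega> - m) = distr (distr M borel X) borel (\<lambda>x. x - m)"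
    by (simp add: distr_distr o_def)
  then show ?thesis
    unfolding law gaussian_def by (simp add: distr_distr o_def)
qed

text \<open>
The Gaussian space is the span of the centred initial state and the disturbances.
\<close>

lemma disturbed_system_of_independent_gaussians:
  fixes x0 :: "'a \<Rightarrow> real^'n"
  assumes "prob_space M" and x0: "distr M borel x0 = gaussian mu0 S0"
    and w: "\<And>k. k < N \<Longrightarrow> distr M borel (w k) = gaussian 0 (W k)"
    and ind: "prob_space.indep_vars M (\<lambda>_. borel) (\<lambda>i. case i of 0 \<Rightarrow> x0 | Suc k \<Rightarrow> w k) {..N}"
  shows "\<exists>G. disturbed_system M G N x0 w mu0"
proof -
  interpret prob_space M by fact
  define \<xi> where "\<xi> i \<omega> = (case i of 0 \<Rightarrow> x0 \<omega> - mu0 | Suc k \<Rightarrow> w k \<omega>)" for i \<omega>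
  have "indep_vars (\<lambda>_. borel)
      (\<lambda>i \<omega>. (\<lambda>i x. if i = 0 then x - mu0 else x) i ((case i of 0 \<Rightarrow> x0 | Suc k \<Rightarrow> w k) \<omega>)) {..N}"
    by (rule indep_vars_compose2[OF ind]) auto
  also have "?this \<longleftrightarrow> indep_vars (\<lambda>_. borel) \<xi> {..N}"
    by (intro indep_vars_cong) (auto simp: \<xi>_def fun_eq_iff split: nat.split)
  finally have ind': "indep_vars (\<lambda>_. borel) \<xi> {..N}" .
  have rv: "(case i of 0 \<Rightarrow> x0 | Suc k \<Rightarrow> w k) \<in> borel_measurable M" if "i \<le> N" for i
    using ind that by (auto simp: indep_vars_def)
  have cg: "centred_gaussian M (\<lambda>\<omega>. t \<bullet> \<xi> i \<omega>)" if "i \<in> {..N}" for i t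
  proof (cases i)
    case 0
    have [measurable]: "x0 \<in> borel_measurable M" using rv[of 0] by simp
    have "centred_gaussian M (\<lambda>\<omega>. t \<bullet> (x0 \<omega> - mu0))"
      by (rule centred_gaussian_of_law[OF _ distr_centred[OF _ x0]]) measurable
    then show ?thesis by (simp add: 0 \<xi>_def)
  next
    case (Suc k)
    have "centred_gaussian M (\<lambda>\<omega>. t \<bullet> w k \<omega>)"
      using rv[of "Suc k"] w[of k] that Suc by (intro centred_gaussian_of_law) auto
    then show ?thesis by (simp add: Suc \<xi>_def)
  qed
  let ?G = "linear_span_of {..N} \<xi>"
  interpret gaussian_space M ?G
    by (rule gaussian_space_indep[OF _ ind' cg]) auto
  have vo: "vec_over ?G (\<xi> i)" if "i \<le> N" for i
    using that by (intro vec_over_linear_span_of) auto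
  have orth: "xcov M (\<xi> i) (\<xi> j) = 0" if "i \<le> N" "j \<le> N" "i \<noteq> j" for i j
    using that by (intro xcov_indep_zero indep_var_components[OF ind'] cg) auto
  have \<xi>0: "\<xi> 0 = (\<lambda>\<omega>. x0 \<omega> - mu0)" and \<xi>S: "\<And>k. \<xi> (Suc k) = w k"
    by (simp_all add: \<xi>_def fun_eq_iff)
  have "disturbed_system M ?G N x0 w mu0"
  proof
    show "vec_over ?G (\<lambda>\<omega>. x0 \<omega> - mu0)" using vo[of 0] by (simp add: \<xi>0)
    show "vec_over ?G (w k)" if "k < N" for k using vo[of "Suc k"] that by (simp add: \<xi>S)
    show "xcov M (\<lambda>\<omega>. x0 \<omega> - mu0) (w k) = 0" if "k < N" for k
      using orth[of 0 "Suc k"] that by (simp add: \<xi>0 \<xi>S)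
    show "xcov M (w j) (w k) = 0" if "j < N" "k < N" "j \<noteq> k" for j k
      using orth[of "Suc j" "Suc k"] that by (simp add: \<xi>S)
  qed
  then show ?thesis ..
qed

text \<open>
The coordinates of the product measure are independent with the prescribed laws, and this is what makes the
randomization of the policy a Gaussian family with covariances $Q_k$.
\<close>

lemma product_of_gaussians:
  fixes Q :: "nat \<Rightarrow> real^'m^'m" and N :: nat
  defines "D \<equiv> \<Pi>\<^sub>M k\<in>{..<N}. gaussian 0 (Q k)"
  defines "H \<equiv> linear_span_of {..<N} (\<lambda>k f. f k)"
  shows "gaussian_space D H"
    and "\<And>k. k < N \<Longrightarrow> vec_over H (\<lambda>f. f k)"
    and "\<And>j k. j < N \<Longrightarrow> k < N \<Longrightarrow> j \<noteq> k \<Longrightarrow> xcov D (\<lambda>f. f j) (\<lambda>f. f k) = 0"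
    and "\<And>k. k < N \<Longrightarrow> psd (Q k) \<Longrightarrow> xcov D (\<lambda>f. f k) (\<lambda>f. f k) = Q k"
proof -
  interpret prob_space D
    unfolding D_def by (intro prob_space_PiM prob_space_gaussian)
  have rv [measurable]: "(\<lambda>f. f k) \<in> borel_measurable D" if "k < N" for k
  proof -
    have "(\<lambda>f. f k) \<in> measurable D (gaussian 0 (Q k))"
      unfolding D_def using that by (intro measurable_component_singleton) simp
    then show ?thesis
      using measurable_cong_sets[OF refl sets_gaussian, of D 0 "Q k"] by blast
  qed
  have law: "distr D borel (\<lambda>f. f k) = gaussian 0 (Q k)" if "k < N" for k
  proof -
    have "distr D borel (\<lambda>f. f k) = distr D (gaussian 0 (Q k)) (\<lambda>f. f k)"
      by (rule distr_cong) auto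
    also have "\<dots> = gaussian 0 (Q k)"
      unfolding D_def using that by (intro distr_PiM_component prob_space_gaussian) simp
    finally show ?thesis .
  qed
  have ind: "indep_vars (\<lambda>_. borel) (\<lambda>k f. f k) {..<N}"
  proof (cases "N = 0")
    case True
    then show ?thesis by (simp add: indep_vars_def indep_sets_def)
  next
    case False
    have "distr D (\<Pi>\<^sub>M k\<in>{..<N}. borel) (\<lambda>f. \<lambda>k\<in>{..<N}. f k) = distr D D (\<lambda>f. f)"
    proof (rule distr_cong)
      show "sets (\<Pi>\<^sub>M k\<in>{..<N}. borel) = sets D"
        unfolding D_def by (intro sets_PiM_cong) auto
      show "(\<lambda>k\<in>{..<N}. f k) = f" if "f \<in> space D" for f
        using that by (auto simp: D_def space_PiM PiE_def extensional_restrict)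
    qed simp
    also have "\<dots> = D" by (simp add: distr_id2)
    also have "D = (\<Pi>\<^sub>M k\<in>{..<N}. distr D borel (\<lambda>f. f k))"
      by (subst D_def, rule PiM_cong) (auto simp: law)
    finally show ?thesis
      using False by (subst indep_vars_iff_distr_eq_PiM') (auto intro: rv)
  qed
  have cg: "centred_gaussian D (\<lambda>f. t \<bullet> f k)" if "k \<in> {..<N}" for t k
    using that by (intro centred_gaussian_of_law[OF rv law]) auto
  show "gaussian_space D H"
    unfolding H_def by (rule gaussian_space_indep[OF _ ind cg]) auto
  then interpret gaussian_space D H .
  show vo: "vec_over H (\<lambda>f. f k)" if "k < N" for k
    unfolding H_def using that vec_over_linear_span_of[of "{..<N}" k "\<lambda>k f. f k"] by simp
  show "xcov D (\<lambda>f. f j) (\<lambda>f. f k) = 0" if "j < N" "k < N" "j \<noteq> k" for j k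
    using that by (intro xcov_indep_zero indep_var_components[OF ind] cg) auto
  show "xcov D (\<lambda>f. f k) (\<lambda>f. f k) = Q k" if k: "k < N" and Q: "psd (Q k)" for k
  proof (rule symmetric_matrix_eq_quadratic)
    show "transpose (Q k) = Q k" using Q by (simp add: psd_def)
    show "transpose (xcov D (\<lambda>f. f k) (\<lambda>f. f k)) = xcov D (\<lambda>f. f k) (\<lambda>f. f k)"
      by (rule transpose_xcov)
    fix t
    have "t \<bullet> (xcov D (\<lambda>f. f k) (\<lambda>f. f k) *v t) = (\<integral>f. (t \<bullet> f k)\<^sup>2 \<partial>D)"
      by (simp add: xcov_bilinear[OF vo[OF k] vo[OF k]] power2_eq_square)
    also have "\<dots> = (\<integral>x. (t \<bullet> x)\<^sup>2 \<partial>distr D borel (\<lambda>f. f k))"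
      using rv[OF k] by (subst integral_distr) auto
    finally show "t \<bullet> (xcov D (\<lambda>f. f k) (\<lambda>f. f k) *v t) = t \<bullet> (Q k *v t)"
      by (simp add: law[OF k] gaussian_linear_form(2)[OF Q])
  qed
qed

text \<open>
Enlarging the probability space preserves the covariances of the original data and adds noises with
the covariances $Q_k$.
\<close>

lemma randomized_system_product:
  fixes Q :: "nat \<Rightarrow> real^'m^'m"
  assumes "disturbed_system M G N x0 w mu0"
  shows "\<exists>G'. randomized_system (rand_space M N Q) G' N (\<lambda>\<omega>. x0 (fst \<omega>)) (\<lambda>k \<omega>. w k (fst \<omega>)) mu0
    (\<lambda>k \<omega>. snd \<omega> k)"
    and "k < N \<Longrightarrow> xcov (rand_space M N Q) (\<lambda>\<omega>. w k (fst \<omega>)) (\<lambda>\<omega>. w k (fst \<omega>)) = xcov M (w k) (w k)"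
    and "xcov (rand_space M N Q) (\<lambda>\<omega>. x0 (fst \<omega>) - mu0) (\<lambda>\<omega>. x0 (fst \<omega>) - mu0)
      = xcov M (\<lambda>\<omega>. x0 \<omega> - mu0) (\<lambda>\<omega>. x0 \<omega> - mu0)"
    and "k < N \<Longrightarrow> psd (Q k) \<Longrightarrow> xcov (rand_space M N Q) (\<lambda>\<omega>. snd \<omega> k) (\<lambda>\<omega>. snd \<omega> k) = Q k"
proof -
  note init = disturbed_system.init[OF assms] and noise = disturbed_system.noise[OF assms]
    and init_noise = disturbed_system.init_noise[OF assms]
    and noise_noise = disturbed_system.noise_noise[OF assms]
  note D1 = product_of_gaussians(1)[where N = N and Q = Q]
    and D2 = product_of_gaussians(2)[where N = N]
    and D3 = product_of_gaussians(3)[where N = N and Q = Q]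
    and D4 = product_of_gaussians(4)[where N = N and Q = Q]
  note prod = gaussian_space_product[OF disturbed_system.axioms(1)[OF assms] D1, folded rand_space_def]
  interpret P: gaussian_space "rand_space M N Q"
    "direct_sum G (linear_span_of {..<N} (\<lambda>k f. f k :: real^'m))"
    by (rule prod(1))
  have "randomized_system (rand_space M N Q) (direct_sum G (linear_span_of {..<N} (\<lambda>k f. f k :: real^'m))) N
    (\<lambda>\<omega>. x0 (fst \<omega>)) (\<lambda>k \<omega>. w k (fst \<omega>)) mu0 (\<lambda>k \<omega>. snd \<omega> k)"
    by unfold_locales
      (simp_all add: prod(2)[OF init] prod(2)[OF noise] prod(4)[OF init noise] prod(4)[OF noise noise]
        init_noise noise_noise prod(3)[OF D2] prod(6)[OF init D2] prod(6)[OF noise D2]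
        prod(5)[OF D2 D2] D3)
  then show "\<exists>G'. randomized_system (rand_space M N Q) G' N (\<lambda>\<omega>. x0 (fst \<omega>)) (\<lambda>k \<omega>. w k (fst \<omega>)) mu0
    (\<lambda>k \<omega>. snd \<omega> k)" ..
  show "k < N \<Longrightarrow> xcov (rand_space M N Q) (\<lambda>\<omega>. w k (fst \<omega>)) (\<lambda>\<omega>. w k (fst \<omega>)) = xcov M (w k) (w k)"
    by (rule prod(4)[OF noise noise])
  show "xcov (rand_space M N Q) (\<lambda>\<omega>. x0 (fst \<omega>) - mu0) (\<lambda>\<omega>. x0 (fst \<omega>) - mu0)
      = xcov M (\<lambda>\<omega>. x0 \<omega> - mu0) (\<lambda>\<omega>. x0 \<omega> - mu0)"
    by (rule prod(4)[OF init init])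
  show "k < N \<Longrightarrow> psd (Q k) \<Longrightarrow> xcov (rand_space M N Q) (\<lambda>\<omega>. snd \<omega> k) (\<lambda>\<omega>. snd \<omega> k) = Q k"
    using prod(5)[OF D2 D2] D4 by simp
qed

section \<open>Matching a history policy by a randomized policy\<close>

text \<open>
The central step: the randomized policy with the regression gain and the residual covariance
matches the second-order statistics of the given history policy at every time, and with them its cost.
\<close>

lemma exists_rand_policy_same_cost:
  fixes \<pi> :: "('n::finite, 'm::finite) hist_policy" and A :: "nat \<Rightarrow> real^'n^'n" and B :: "nat \<Rightarrow> real^'m^'n"
  assumes sys: "disturbed_system M G N x0 w mu0"
    and nondeg: "\<And>k. k < N \<Longrightarrow> pd (covariance M (hist_state M A B x0 w \<pi> k))"
  shows "\<exists>\<pi>'\<in>rand_policies N. rand_cost M N A B x0 w R lam \<rho>d \<pi>' = hist_cost M N A B x0 w R lam \<rho>d \<pi>"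
proof -
  interpret H: disturbed_system M G N A B x0 w mu0 by fact
  define X where "X = H.hist_dev \<pi>"
  define U where "U = H.hist_input_dev \<pi>"
  define v where "v = fst \<pi>"
  have vX: "vec_over G (X k)" if "k \<le> N" for k
    using that unfolding X_def by (rule H.vec_over_hist_dev)
  have vU: "vec_over G (U k)" if "k < N" for k
    using that unfolding U_def by (rule H.vec_over_hist_input_dev)
  have pdX: "pd (xcov M (X k) (X k))" if "k < N" for k
    using nondeg[OF that] H.covariance_eq_xcov[OF vX, of k] that
    by (simp add: X_def H.hist_state_split)
  define K where "K k = xcov M (U k) (X k) ** matrix_inv (xcov M (X k) (X k))" for k
  define V where "V k \<omega> = U k \<omega> - K k *v X k \<omega>" for k \<omega>
  define Q where "Q k = xcov M (V k) (V k)" for k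
  have vV: "vec_over G (V k)" if "k < N" for k
    unfolding V_def[abs_def] using that
    by (intro H.vec_over_diff vU H.vec_over_matrix vX) auto
  have VX: "xcov M (V k) (X k) = 0" if "k < N" for k
    using H.regression_residual_orthogonal[OF vX[of k] vU[of k] pdX[of k]] that
    by (simp add: V_def[abs_def] K_def)
  have U_eq: "U k = (\<lambda>\<omega>. K k *v X k \<omega> + V k \<omega>)" for k
    by (simp add: V_def fun_eq_iff)
  have psdQ: "psd (Q k)" if "k < N" for k
    unfolding Q_def using H.psd_xcov[OF vV[OF that]] .
  let ?P = "rand_space M N Q"
  let ?x0 = "\<lambda>\<omega>. x0 (fst \<omega>)" and ?w = "\<lambda>k \<omega>. w k (fst \<omega>)" and ?nz = "\<lambda>k \<omega>. snd \<omega> k"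
  note lift = randomized_system_product[OF sys, where Q = Q]
  obtain G' where "randomized_system ?P G' N ?x0 ?w mu0 ?nz"
    using lift(1) by blast
  then interpret S: randomized_system ?P G' N A B ?x0 ?w mu0 ?nz .
  define X' where "X' = S.rand_dev v K"
  define U' where "U' = S.rand_input_dev v K"
  have vX': "vec_over G' (X' k)" if "k \<le> N" for k
    using that unfolding X'_def by (rule S.vec_over_rand_dev)
  have vU': "vec_over G' (U' k)" if "k < N" for k
    using that unfolding U'_def by (rule S.vec_over_rand_input_dev)
  have U'_eq: "U' k = (\<lambda>\<omega>. K k *v X' k \<omega> + ?nz k \<omega>)" for k
    by (simp add: U'_def X'_def S.rand_input_dev_def fun_eq_iff)
  \<comment> \<open>one time step, first half: equal state covariances give equal input statistics\<close>
  have input_cov: "xcov ?P (U' k) (X' k) = xcov M (U k) (X k)" "xcov ?P (U' k) (U' k) = xcov M (U k) (U k)"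
    if k: "k < N" and eq: "xcov ?P (X' k) (X' k) = xcov M (X k) (X k)" for k
  proof -
    have nX: "xcov ?P (?nz k) (X' k) = 0"
      unfolding X'_def using k by (rule S.xcov_nz_rand_dev)
    have "xcov ?P (?nz k) (?nz k) = xcov M (V k) (V k)"
      using lift(4)[OF k psdQ[OF k]] by (simp add: Q_def)
    then show "xcov ?P (U' k) (X' k) = xcov M (U k) (X k)" "xcov ?P (U' k) (U' k) = xcov M (U k) (U k)"
      unfolding U_eq U'_eq using k vX[of k] vX'[of k]
      by (simp_all add: H.xcov_pythagoras[OF _ vV VX] S.xcov_pythagoras[OF _ S.nz nX] eq)
  qed
  \<comment> \<open>second half and induction: equal input statistics propagate the state covariance\<close>
  have state_cov: "xcov ?P (X' k) (X' k) = xcov M (X k) (X k)" if "k \<le> N" for k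
    using that
  proof (induction k)
    case 0
    show ?case
      using lift(3) by (simp add: X'_def X_def S.rand_dev_def[abs_def] H.hist_dev_def[abs_def])
  next
    case (Suc k)
    then have k: "k < N" and eq: "xcov ?P (X' k) (X' k) = xcov M (X k) (X k)" by auto
    have X: "X (Suc k) = (\<lambda>\<omega>. A k *v X k \<omega> + B k *v U k \<omega> + w k \<omega>)"
      unfolding X_def U_def by (rule H.hist_dev_Suc) (use k in \<open>auto intro: H.vec_over_hist_dev\<close>)
    have X': "X' (Suc k) = (\<lambda>\<omega>. A k *v X' k \<omega> + B k *v U' k \<omega> + ?w k \<omega>)"
      unfolding X'_def U'_def by (rule S.rand_dev_Suc) (use k in \<open>auto intro: S.vec_over_rand_dev\<close>)
    have "xcov M (X k) (w k) = 0"
      unfolding X_def using H.hist_dev_orthogonal[of k \<pi>] k by auto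
    moreover have "xcov ?P (X' k) (?w k) = 0"
      unfolding X'_def using S.rand_dev_orthogonal[of k v K] k by auto
    ultimately show ?case
      unfolding X X' using k vX[of k] vX'[of k]
        H.xcov_hist_input_dev_noise[OF k, of \<pi>, folded U_def]
        S.xcov_rand_input_dev_noise[OF k, of v K, folded U'_def]
      by (simp add: H.xcov_linear_update[OF _ vU[OF k] H.noise[OF k]]
          S.xcov_linear_update[OF _ vU'[OF k] S.noise[OF k]] eq input_cov[OF k eq] lift(2)[OF k])
  qed
  have input: "hist_input M A B x0 w \<pi> k = (\<lambda>\<omega>. v k + U k \<omega>)" if "k < N" for k
    unfolding v_def U_def by (rule H.hist_input_split) (use that in \<open>auto intro: H.vec_over_hist_dev\<close>)
  have input': "rand_input ?P A B ?x0 ?w ?nz v K k = (\<lambda>\<omega>. v k + U' k \<omega>)" if "k < N" for k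
    unfolding U'_def by (rule S.rand_input_split) (use that in \<open>auto intro: S.vec_over_rand_dev\<close>)
  have "(\<integral>\<omega>. (\<Sum>k<N. rand_input ?P A B ?x0 ?w ?nz v K k \<omega> \<bullet> (R k *v rand_input ?P A B ?x0 ?w ?nz v K k \<omega>)) \<partial>?P)
      = (\<integral>\<omega>. (\<Sum>k<N. (v k + U' k \<omega>) \<bullet> (R k *v (v k + U' k \<omega>))) \<partial>?P)"
    by (simp add: input')
  also have "\<dots> = (\<Sum>k<N. v k \<bullet> (R k *v v k)
      + (\<Sum>i\<in>UNIV. \<Sum>j\<in>UNIV. R k $ i $ j * xcov ?P (U' k) (U' k) $ i $ j))"
    by (rule S.integral_running_cost) (rule vU')
  also have "\<dots> = (\<Sum>k<N. v k \<bullet> (R k *v v k)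
      + (\<Sum>i\<in>UNIV. \<Sum>j\<in>UNIV. R k $ i $ j * xcov M (U k) (U k) $ i $ j))"
    by (rule sum.cong) (simp_all add: input_cov(2) state_cov)
  also have "\<dots> = (\<integral>\<omega>. (\<Sum>k<N. (v k + U k \<omega>) \<bullet> (R k *v (v k + U k \<omega>))) \<partial>M)"
    by (rule H.integral_running_cost[symmetric]) (rule vU)
  also have "\<dots> = (\<integral>\<omega>. (\<Sum>k<N. hist_input M A B x0 w \<pi> k \<omega> \<bullet> (R k *v hist_input M A B x0 w \<pi> k \<omega>)) \<partial>M)"
    by (simp add: input del: hist_input.simps)
  finally have running: "(\<integral>\<omega>. (\<Sum>k<N. rand_input ?P A B ?x0 ?w ?nz v K k \<omega> \<bullet> (R k *v rand_input ?P A B ?x0 ?w ?nz v K k \<omega>)) \<partial>?P)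
      = (\<integral>\<omega>. (\<Sum>k<N. hist_input M A B x0 w \<pi> k \<omega> \<bullet> (R k *v hist_input M A B x0 w \<pi> k \<omega>)) \<partial>M)" .
  \<comment> \<open>equal mean and covariance of the Gaussian terminal states give equal laws\<close>
  have law: "distr ?P borel (rand_state ?P A B ?x0 ?w ?nz v K N) = distr M borel (hist_state M A B x0 w \<pi> N)"
    unfolding S.rand_state_split H.hist_state_split
    using distr_eq_of_xcov_eq[OF S.gaussian_space_axioms H.gaussian_space_axioms vX'[OF order_refl] vX[OF order_refl] state_cov[OF order_refl]]
    by (simp add: X_def X'_def v_def)
  have "rand_cost M N A B x0 w R lam \<rho>d (v, K, Q) = hist_cost M N A B x0 w R lam \<rho>d \<pi>"
    unfolding rand_cost_def hist_cost_def steering_cost_def Let_def prod.case running law ..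
  moreover have "(v, K, Q) \<in> rand_policies N"
    using psdQ by (simp add: rand_policies_def)
  ultimately show ?thesis by blast
qed

theorem theorem1:
  fixes M :: "'a measure" and N :: nat
    and A :: "nat \<Rightarrow> real ^ 'n ^ 'n" and B :: "nat \<Rightarrow> real ^ 'm ^ 'n"
    and x0 :: "'a \<Rightarrow> real ^ 'n" and w :: "nat \<Rightarrow> 'a \<Rightarrow> real ^ 'n"
    and mu0 mud :: "real ^ 'n" and S0 Sd :: "real ^ 'n ^ 'n"
    and W :: "nat \<Rightarrow> real ^ 'n ^ 'n" and R :: "nat \<Rightarrow> real ^ 'm ^ 'm" and lam :: real
    and \<pi>1 :: "('n, 'm) hist_policy" and \<pi>2 :: "('n, 'm) rand_policy"
  assumes "prob_space M"
    and "pd S0" and "distr M borel x0 = gaussian mu0 S0"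
    and "\<And>k. k < N \<Longrightarrow> psd (W k)"
    and "\<And>k. k < N \<Longrightarrow> distr M borel (w k) = gaussian 0 (W k)"
    and "prob_space.indep_vars M (\<lambda>_. borel) (\<lambda>i. case i of 0 \<Rightarrow> x0 | Suc k \<Rightarrow> w k) {..N}"
    and "\<And>k. k < N \<Longrightarrow> pd (R k)" and "lam > 0" and "pd Sd"
    and "\<And>\<pi> k. \<pi> \<in> hist_policies \<Longrightarrow> k \<le> N \<Longrightarrow>
           pd (covariance M (hist_state M A B x0 w \<pi> k))"
    and "is_arg_min (hist_cost M N A B x0 w R lam (gaussian mud Sd)) (\<lambda>\<pi>. \<pi> \<in> hist_policies) \<pi>1"
    and "is_arg_min (rand_cost M N A B x0 w R lam (gaussian mud Sd)) (\<lambda>\<pi>. \<pi> \<in> rand_policies N) \<pi>2"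
  shows "rand_cost M N A B x0 w R lam (gaussian mud Sd) \<pi>2
           \<le> hist_cost M N A B x0 w R lam (gaussian mud Sd) \<pi>1"
proof -
  obtain G where "disturbed_system M G N x0 w mu0"
    using disturbed_system_of_independent_gaussians[OF assms(1,3,5,6)] by blast
  moreover have "pd (covariance M (hist_state M A B x0 w \<pi>1 k))" if "k < N" for k
    using assms(10)[of \<pi>1 k] that by (simp add: hist_policies_def)
  ultimately obtain \<pi> where \<pi>: "\<pi> \<in> rand_policies N"
    "rand_cost M N A B x0 w R lam (gaussian mud Sd) \<pi> = hist_cost M N A B x0 w R lam (gaussian mud Sd) \<pi>1"
    using exists_rand_policy_same_cost by blast
  then show ?thesis
    using assms(12) unfolding is_arg_min_def by (metis not_less)
qed

end
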